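(* Let $(R,\mathfrak{m})$ be a Cohen-Macaulay local ring. Then, for any two minimal prime ideals $\wp$ and $\wp'$ of $R$ and for each prime ideal $\mathcal{P}\supseteq\wp+\wp'$, there exists a sequence $\wp=\wp_1,\ldots,\wp_s=\wp'$ such that $\wp_j\subseteq\mathcal{P}$ is a minimal prime of $R$ for each $j=1,\ldots,s$, and $\mathrm{ht}(\wp_i+\wp_{i+1})\leq 1$ for each $i=1,\ldots,s-1$. In particular, $R$ is connected in codimension $1$.
   Context: For a noetherian topological space $T$, the connectivity dimension is $\mathrm{c}(T):=\min\{\dim Z : Z\subseteq T \text{ closed and } T\setminus Z \text{ disconnected}\}$, with the convention that the empty set is disconnected and has dimension $-1$. A noetherian ring $A$ is connected in codimension $1$ if $\mathrm{c}(\mathrm{Spec}\,A)\geq\dim A-1$. *)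

theory Defs
  imports
    "HOL-Algebra.Ring_Divisibility"
    "HOL-Algebra.QuotRing"
    "HOL-Analysis.Abstract_Topology"
    "HOL-Library.Extended_Real"
begin

section \<open>Chains and dimension of topological spaces\<close>

(* A list of length n + 1 represents a chain Z_0 < ... < Z_n, whose length is n. The empty list
   is admitted, with length -1, so that the supremum over an empty family F is -1. *)
definition chain_dim :: "'a set set \<Rightarrow> ereal" where
  "chain_dim F = Sup {ereal (real (length c) - 1) | c. set c \<subseteq> F \<and> sorted_wrt (\<subset>) c}"

lemma chain_dim_empty: "chain_dim {} = -1"
  by (simp add: chain_dim_def one_ereal_def)

definition irreducible_closedin :: "'a topology \<Rightarrow> 'a set \<Rightarrow> bool" where
  "irreducible_closedin X Z \<longleftrightarrow> closedin X Z \<and> Z \<noteq> {} \<and>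
     (\<forall>A B. closedin X A \<and> closedin X B \<and> Z = A \<union> B \<longrightarrow> Z = A \<or> Z = B)"

definition top_dim :: "'a topology \<Rightarrow> ereal" where
  "top_dim X = chain_dim {Z. irreducible_closedin X Z}"

(* The library's connected_space holds of the empty space; here the empty space is disconnected. *)
definition disconnected_space :: "'a topology \<Rightarrow> bool" where
  "disconnected_space X \<longleftrightarrow> topspace X = {} \<or> \<not> connected_space X"

(* The infimum is a minimum: the family is nonempty (take Z = topspace X) and all its members
   lie in {-1, 0, 1, ..., \<infinity>}. *)
definition connectivity_dim :: "'a topology \<Rightarrow> ereal" where
  "connectivity_dim X =
     Inf {top_dim (subtopology X Z) | Z.
            closedin X Z \<and> disconnected_space (subtopology X (topspace X - Z))}"

section \<open>Prime spectrum, Krull dimension and height\<close>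

definition Spec :: "('a, 'm) ring_scheme \<Rightarrow> 'a set set" where
  "Spec R = {P. primeideal P R}"

definition zariski_topology :: "('a, 'm) ring_scheme \<Rightarrow> 'a set topology" where
  "zariski_topology R =
     topology (\<lambda>U. \<exists>E \<subseteq> carrier R. U = Spec R - {P \<in> Spec R. E \<subseteq> P})"

definition krull_dim :: "('a, 'm) ring_scheme \<Rightarrow> ereal" where
  "krull_dim R = chain_dim (Spec R)"

definition minimal_primes :: "('a, 'm) ring_scheme \<Rightarrow> 'a set set" where
  "minimal_primes R = {P \<in> Spec R. \<forall>Q \<in> Spec R. Q \<subseteq> P \<longrightarrow> Q = P}"

definition height_prime :: "('a, 'm) ring_scheme \<Rightarrow> 'a set \<Rightarrow> ereal" where
  "height_prime R P =
     Sup {ereal (real (length c) - 1) | c.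
            c \<noteq> [] \<and> last c = P \<and> set c \<subseteq> Spec R \<and> sorted_wrt (\<subset>) c}"

(* The unit ideal has height \<infinity>. *)
definition height :: "('a, 'm) ring_scheme \<Rightarrow> 'a set \<Rightarrow> ereal" where
  "height R I = (INF P \<in> {P \<in> Spec R. I \<subseteq> P}. height_prime R P)"

definition connected_in_codim_1 :: "('a, 'm) ring_scheme \<Rightarrow> bool" where
  "connected_in_codim_1 R \<longleftrightarrow> connectivity_dim (zariski_topology R) \<ge> krull_dim R - 1"

lemma istopology_zariski:
  fixes R :: "('a, 'm) ring_scheme"
  shows "istopology (\<lambda>U. \<exists>E \<subseteq> carrier R. U = Spec R - {P \<in> Spec R. E \<subseteq> P})"
    (is "istopology ?open")
  unfolding istopology_def
proof (intro conjI allI impI)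
  fix U V
  assume "?open U" "?open V"
  then obtain E F where
    E: "E \<subseteq> carrier R" "U = Spec R - {P \<in> Spec R. E \<subseteq> P}" and
    F: "F \<subseteq> carrier R" "V = Spec R - {P \<in> Spec R. F \<subseteq> P}"
    by blast
  define G where "G = {x \<otimes>\<^bsub>R\<^esub> y | x y. x \<in> E \<and> y \<in> F}"
  show "?open (U \<inter> V)"
  proof (cases "Spec R = {}")
    case True
    then show ?thesis using E F by blast
  next
    case False
    then obtain P0 where "primeideal P0 R" by (auto simp: Spec_def)
    then interpret cring R by (rule primeideal.axioms(2))
    have G: "G \<subseteq> carrier R"
      using E(1) F(1) by (auto simp: G_def)
    have "G \<subseteq> P \<longleftrightarrow> E \<subseteq> P \<or> F \<subseteq> P" if "P \<in> Spec R" for P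
    proof -
      interpret P: primeideal P R using that by (simp add: Spec_def)
      show ?thesis
      proof
        assume GP: "G \<subseteq> P"
        show "E \<subseteq> P \<or> F \<subseteq> P"
        proof (rule ccontr)
          assume "\<not> (E \<subseteq> P \<or> F \<subseteq> P)"
          then obtain x y where xy: "x \<in> E" "x \<notin> P" "y \<in> F" "y \<notin> P" by blast
          then have "x \<otimes>\<^bsub>R\<^esub> y \<in> P" using GP by (auto simp: G_def)
          with xy E(1) F(1) P.I_prime show False by blast
        qed
      next
        assume "E \<subseteq> P \<or> F \<subseteq> P"
        then show "G \<subseteq> P"
          using E(1) F(1) P.I_l_closed P.I_r_closed unfolding G_def by blast
      qed
    qed
    then have "U \<inter> V = Spec R - {P \<in> Spec R. G \<subseteq> P}"
      using E(2) F(2) by blast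
    with G show ?thesis by blast
  qed
next
  fix K
  assume K: "\<forall>U\<in>K. ?open U"
  then obtain E where E: "\<And>U. U \<in> K \<Longrightarrow> E U \<subseteq> carrier R"
    "\<And>U. U \<in> K \<Longrightarrow> U = Spec R - {P \<in> Spec R. E U \<subseteq> P}"
    by metis
  have "(\<Union>U\<in>K. E U) \<subseteq> carrier R" using E(1) by blast
  moreover have "\<Union>K = Spec R - {P \<in> Spec R. (\<Union>U\<in>K. E U) \<subseteq> P}"
  proof (rule Set.set_eqI)
    fix P
    have "P \<in> \<Union>K \<longleftrightarrow> (\<exists>U\<in>K. P \<in> Spec R \<and> \<not> E U \<subseteq> P)"
      using E(2) by blast
    then show "P \<in> \<Union>K \<longleftrightarrow> P \<in> Spec R - {P \<in> Spec R. (\<Union>U\<in>K. E U) \<subseteq> P}"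
      by blast
  qed
  ultimately show "?open (\<Union>K)" by blast
qed

lemma openin_zariski:
  "openin (zariski_topology R) U \<longleftrightarrow>
     (\<exists>E \<subseteq> carrier R. U = Spec R - {P \<in> Spec R. E \<subseteq> P})"
  by (simp only: zariski_topology_def topology_inverse'[OF istopology_zariski])

lemma topspace_zariski: "topspace (zariski_topology R) = Spec R"
proof
  show "topspace (zariski_topology R) \<subseteq> Spec R"
    using openin_topspace[of "zariski_topology R"] unfolding openin_zariski by blast
  have "\<not> carrier R \<subseteq> P" if "P \<in> Spec R" for P
  proof -
    interpret primeideal P R using that by (simp add: Spec_def)
    show ?thesis using I_notcarr a_subset by blast
  qed
  then have "openin (zariski_topology R) (Spec R)"
    unfolding openin_zariski by blast
  then show "Spec R \<subseteq> topspace (zariski_topology R)" by (rule openin_subset)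
qed

lemma closedin_zariski:
  "closedin (zariski_topology R) Z \<longleftrightarrow> (\<exists>E \<subseteq> carrier R. Z = {P \<in> Spec R. E \<subseteq> P})"
  unfolding closedin_def topspace_zariski openin_zariski by blast

section \<open>Cohen-Macaulay local rings\<close>

definition nonzerodivisor :: "('a, 'm) ring_scheme \<Rightarrow> 'a \<Rightarrow> bool" where
  "nonzerodivisor R a \<longleftrightarrow> a \<in> carrier R \<and>
     (\<forall>b \<in> carrier R. a \<otimes>\<^bsub>R\<^esub> b = \<zero>\<^bsub>R\<^esub> \<longrightarrow> b = \<zero>\<^bsub>R\<^esub>)"

definition regular_sequence :: "('a, 'm) ring_scheme \<Rightarrow> 'a list \<Rightarrow> bool" where
  "regular_sequence R xs \<longleftrightarrow> set xs \<subseteq> carrier R \<and>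
     Idl\<^bsub>R\<^esub> (set xs) \<noteq> carrier R \<and>
     (\<forall>i < length xs. let I = Idl\<^bsub>R\<^esub> (set (take i xs)) in
        nonzerodivisor (R Quot I) (I +>\<^bsub>R\<^esub> (xs ! i)))"

definition depth :: "('a, 'm) ring_scheme \<Rightarrow> 'a set \<Rightarrow> ereal" where
  "depth R I = Sup {ereal (real (length xs)) | xs. set xs \<subseteq> I \<and> regular_sequence R xs}"

locale noetherian_local_ring = cring R + noetherian_ring R
  for R :: "('a, 'm) ring_scheme" (structure) and \<mm> :: "'a set" +
  assumes maximal: "maximalideal \<mm> R"
    and unique: "maximalideal J R \<Longrightarrow> J = \<mm>"

locale cohen_macaulay_local_ring = noetherian_local_ring +
  assumes depth_eq_dim: "depth R \<mm> = krull_dim R"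

end

theory Submission
  imports Defs
begin

text \<open>The combinatorial claim and connectedness in codimension one both rest on a local form of
  Hartshorne's theorem (\<open>components_meet_in_codim_1\<close>): if the minimal primes of \<open>R\<close> are divided into
  two sets, each with a member inside a prime \<open>P\<close>, then some prime of height at most one inside \<open>P\<close>
  contains a minimal prime from each set. Applied to the minimal primes that can be reached from
  a given one and to the remaining ones, it yields the required paths.

  Hartshorne's argument takes the ideals \<open>I\<close> and \<open>J\<close> of elements that vanish near the one and near the
  other set of components. If the claim failed, \<open>I + J\<close> would locally lie in no prime of height at most
  one, and therefore would contain elements \<open>x\<close>, \<open>y\<close> that form a regular sequence in the localization
  at \<open>P\<close>. Since \<open>I J = 0\<close>, comparing the \<open>I\<close>-parts of \<open>x\<close> and \<open>y\<close> produces a nontrivial idempotent in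
  that local ring, which is absurd.

  The Cohen-Macaulay property is needed here to know that the associated primes of \<open>R\<close> are the
  minimal primes, and that those of \<open>R / x R\<close>, for a nonzerodivisor \<open>x\<close>, have height at most one.
  Both follow from one estimate (\<open>exists_prime_chain_above_ass\<close>): from an associated prime of \<open>R\<close>
  modulo a regular sequence of length \<open>k\<close>, a chain of length at least the depth minus \<open>k\<close> ascends,
  because each further regular element strictly enlarges an associated prime
  (\<open>ass_strictly_increases\<close>). That every regular sequence extends to one of maximal length is
  the exchange property \<open>mm_ass_regseq_exchange\<close>; it also shows that the depth, and hence the
  dimension, is finite. As depth and dimension agree, a prime at the start of such a chain has
  height at most \<open>k\<close>.

  For connectedness, let the complement of a closed set \<open>Z\<close> be disconnected. Unless \<open>Z\<close> contains a minimal
  prime, a path of minimal primes leads from one part of the complement to the other, and where it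
  changes parts, a prime of height one above two consecutive minimal primes must lie in \<open>Z\<close>. The
  estimate above provides a chain of length at least the dimension minus one that starts at this
  prime and stays in \<open>Z\<close>.\<close>

section \<open>Associated primes in noetherian rings\<close>

locale noetherian_cring = cring R + noetherian_ring R for R (structure)

context cring
begin

text \<open>Properties of the ring \<open>R / I\<close> and of its localizations are expressed in \<open>R\<close>, relative to the
  ideal \<open>I\<close>. In this way a whole sequence of quotients can be treated within a single ring: \<open>ass I\<close>
  consists of the associated primes of \<open>R / I\<close>, and \<open>nzd_mod I x\<close> says that \<open>x\<close> is a nonzerodivisor
  on \<open>R / I\<close>.\<close>
definition colon :: "'a set \<Rightarrow> 'a \<Rightarrow> 'a set" where
  "colon I v = {r \<in> carrier R. r \<otimes> v \<in> I}"

definition ass :: "'a set \<Rightarrow> 'a set set" where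
  "ass I = {P. primeideal P R \<and> (\<exists>v \<in> carrier R. P = colon I v)}"

definition nzd_mod :: "'a set \<Rightarrow> 'a \<Rightarrow> bool" where
  "nzd_mod I x \<longleftrightarrow> x \<in> carrier R \<and> (\<forall>b \<in> carrier R. x \<otimes> b \<in> I \<longrightarrow> b \<in> I)"

definition adjoin :: "'a set \<Rightarrow> 'a \<Rightarrow> 'a set" where
  "adjoin I x = {i \<oplus> r \<otimes> x | i r. i \<in> I \<and> r \<in> carrier R}"

text \<open>The elements that become members of \<open>I\<close> after localization at \<open>Q\<close>.\<close>
definition sat :: "'a set \<Rightarrow> 'a set \<Rightarrow> 'a set" where
  "sat I Q = {a \<in> carrier R. \<exists>s \<in> carrier R. s \<notin> Q \<and> s \<otimes> a \<in> I}"

definition prime_chain :: "'a set list \<Rightarrow> bool" where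
  "prime_chain c \<longleftrightarrow> c \<noteq> [] \<and> set c \<subseteq> Spec R \<and> sorted_wrt (\<subset>) c"

lemma ideal_carrier: "ideal I R \<Longrightarrow> a \<in> I \<Longrightarrow> a \<in> carrier R"
  by (rule ideal.Icarr)

lemma ideal_add: "ideal I R \<Longrightarrow> a \<in> I \<Longrightarrow> b \<in> I \<Longrightarrow> a \<oplus> b \<in> I"
  by (simp add: additive_subgroup.a_closed ideal.axioms(1))

lemma ideal_zero: "ideal I R \<Longrightarrow> \<zero> \<in> I"
  by (simp add: additive_subgroup.zero_closed ideal.axioms(1))

lemma ideal_minus: "ideal I R \<Longrightarrow> a \<in> I \<Longrightarrow> b \<in> I \<Longrightarrow> a \<ominus> b \<in> I"
  by (metis a_minus_def additive_subgroup.a_closed additive_subgroup.a_inv_closed ideal.axioms(1))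

lemma ideal_cancel:
  assumes "ideal I R" "a \<oplus> b \<in> I" "a \<in> I" "b \<in> carrier R"
  shows "b \<in> I"
proof -
  have a: "a \<in> carrier R" using assms ideal_carrier by blast
  have "(a \<oplus> b) \<ominus> a \<in> I" using assms ideal_minus by blast
  moreover have "(a \<oplus> b) \<ominus> a = b" using a assms(4) by algebra
  ultimately show ?thesis by simp
qed

lemma idealI_elementwise:
  assumes "I \<subseteq> carrier R" "\<zero> \<in> I"
    and add: "\<And>a b. a \<in> I \<Longrightarrow> b \<in> I \<Longrightarrow> a \<oplus> b \<in> I"
    and mult: "\<And>a r. a \<in> I \<Longrightarrow> r \<in> carrier R \<Longrightarrow> r \<otimes> a \<in> I"
  shows "ideal I R"
proof (rule idealI[OF ring_axioms])
  have "\<ominus> a \<in> I" if "a \<in> I" for a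
    using mult[OF that, of "\<ominus> \<one>"] that assms(1) by (auto simp: l_minus)
  then show "subgroup I (add_monoid R)"
    using assms by (intro add.subgroupI) (auto simp: a_inv_def[symmetric])
  show "x \<otimes> a \<in> I" "a \<otimes> x \<in> I" if "a \<in> I" "x \<in> carrier R" for a x
    using mult[OF that] that assms(1) m_comm[of a x] by auto
qed

lemma colon_ideal:
  assumes I: "ideal I R" and v: "v \<in> carrier R"
  shows "ideal (colon I v) R"
proof (rule idealI_elementwise)
  show "a \<oplus> b \<in> colon I v" if "a \<in> colon I v" "b \<in> colon I v" for a b
    using that v ideal_add[OF I] by (auto simp: colon_def l_distr)
  show "r \<otimes> a \<in> colon I v" if "a \<in> colon I v" "r \<in> carrier R" for a r
    using that v ideal.I_l_closed[OF I] by (auto simp: colon_def m_assoc)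
qed (use v ideal_zero[OF I] in \<open>auto simp: colon_def\<close>)

lemma colon_superset: "ideal I R \<Longrightarrow> v \<in> carrier R \<Longrightarrow> I \<subseteq> colon I v"
  using ideal.I_r_closed ideal_carrier by (fastforce simp: colon_def)

lemma adjoin_ideal:
  assumes I: "ideal I R" and x: "x \<in> carrier R"
  shows "ideal (adjoin I x) R"
proof (rule idealI_elementwise)
  note carr = ideal_carrier[OF I]
  show "adjoin I x \<subseteq> carrier R" using carr x by (auto simp: adjoin_def)
  have "\<zero> = \<zero> \<oplus> \<zero> \<otimes> x" using x by simp
  then show "\<zero> \<in> adjoin I x"
    using ideal_zero[OF I] unfolding adjoin_def by blast
  show "a \<oplus> b \<in> adjoin I x" if "a \<in> adjoin I x" "b \<in> adjoin I x" for a b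
  proof -
    from that obtain i r j s where *: "i \<in> I" "r \<in> carrier R" "a = i \<oplus> r \<otimes> x"
      "j \<in> I" "s \<in> carrier R" "b = j \<oplus> s \<otimes> x" by (auto simp: adjoin_def)
    then have "i \<in> carrier R" "j \<in> carrier R" using carr by auto
    with * x have "a \<oplus> b = (i \<oplus> j) \<oplus> (r \<oplus> s) \<otimes> x" by algebra
    with * ideal_add[OF I] show ?thesis unfolding adjoin_def by blast
  qed
  show "s \<otimes> a \<in> adjoin I x" if "a \<in> adjoin I x" "s \<in> carrier R" for a s
  proof -
    from that obtain i r where *: "i \<in> I" "r \<in> carrier R" "a = i \<oplus> r \<otimes> x"
      by (auto simp: adjoin_def)
    then have "i \<in> carrier R" using carr by auto
    with * x that have "s \<otimes> a = s \<otimes> i \<oplus> (s \<otimes> r) \<otimes> x" by algebra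
    with * that ideal.I_l_closed[OF I] show ?thesis unfolding adjoin_def by blast
  qed
qed

lemma adjoin_superset:
  assumes "ideal I R" "x \<in> carrier R"
  shows "I \<subseteq> adjoin I x" "x \<in> adjoin I x"
proof
  fix a assume "a \<in> I"
  moreover from this have "a = a \<oplus> \<zero> \<otimes> x" using assms ideal_carrier by auto
  ultimately show "a \<in> adjoin I x" unfolding adjoin_def by blast
next
  have "x = \<zero> \<oplus> \<one> \<otimes> x" using assms by simp
  then show "x \<in> adjoin I x" using ideal_zero[OF assms(1)] unfolding adjoin_def by blast
qed

lemma adjoin_least:
  assumes "ideal J R" "I \<subseteq> J" "x \<in> J"
  shows "adjoin I x \<subseteq> J"
  using assms ideal_add[OF assms(1)] ideal.I_l_closed[OF assms(1)] by (auto simp: adjoin_def)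

lemma adjoin_commute:
  assumes "ideal I R" "x \<in> carrier R" "y \<in> carrier R"
  shows "adjoin (adjoin I x) y = adjoin (adjoin I y) x"
proof -
  have "adjoin (adjoin I x) y \<subseteq> adjoin (adjoin I y) x" if "x \<in> carrier R" "y \<in> carrier R" for x y
    using that assms(1) adjoin_superset adjoin_ideal
    by (meson adjoin_least subset_iff)
  then show ?thesis using assms by blast
qed

lemma summands_subset_sum:
  assumes "ideal I R" "ideal J R"
  shows "I \<subseteq> I <+>\<^bsub>R\<^esub> J" "J \<subseteq> I <+>\<^bsub>R\<^esub> J"
proof -
  show "I \<subseteq> I <+>\<^bsub>R\<^esub> J"
  proof
    fix i assume "i \<in> I"
    moreover from this have "i = i \<oplus> \<zero>" using ideal_carrier[OF assms(1)] by simp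
    ultimately show "i \<in> I <+>\<^bsub>R\<^esub> J" using ideal_zero[OF assms(2)] unfolding set_add_def' by blast
  qed
  show "J \<subseteq> I <+>\<^bsub>R\<^esub> J"
  proof
    fix j assume "j \<in> J"
    moreover from this have "j = \<zero> \<oplus> j" using ideal_carrier[OF assms(2)] by simp
    ultimately show "j \<in> I <+>\<^bsub>R\<^esub> J" using ideal_zero[OF assms(1)] unfolding set_add_def' by blast
  qed
qed

lemma prime_proper: "primeideal P R \<Longrightarrow> \<one> \<notin> P"
  by (metis ideal.one_imp_carrier primeideal.I_notcarr primeideal.axioms(1))

lemma assD: "P \<in> ass I \<Longrightarrow> primeideal P R" "P \<in> ass I \<Longrightarrow> ideal P R"
  by (auto simp: ass_def primeideal.axioms(1))

lemma ass_superset: "ideal I R \<Longrightarrow> P \<in> ass I \<Longrightarrow> I \<subseteq> P"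
  using colon_superset by (auto simp: ass_def)

lemma prime_mult_notin:
  assumes "primeideal P R" "a \<in> carrier R" "b \<in> carrier R" "a \<notin> P" "b \<notin> P"
  shows "a \<otimes> b \<notin> P"
  using primeideal.I_prime[OF assms(1-3)] assms(4,5) by blast

lemma sat_ideal:
  assumes I: "ideal I R" and Q: "primeideal Q R"
  shows "ideal (sat I Q) R"
proof (rule idealI_elementwise)
  show "\<zero> \<in> sat I Q"
    using prime_proper[OF Q] ideal_zero[OF I] unfolding sat_def by auto
  fix a assume a: "a \<in> sat I Q"
  then obtain s where s: "a \<in> carrier R" "s \<in> carrier R" "s \<notin> Q" "s \<otimes> a \<in> I"
    by (auto simp: sat_def)
  show "r \<otimes> a \<in> sat I Q" if r: "r \<in> carrier R" for r
  proof -
    have "s \<otimes> (r \<otimes> a) = r \<otimes> (s \<otimes> a)" using s r by algebra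
    then have "s \<otimes> (r \<otimes> a) \<in> I" using ideal.I_l_closed[OF I s(4) r] by simp
    with s r show ?thesis by (auto simp: sat_def)
  qed
  fix b assume "b \<in> sat I Q"
  then obtain t where t: "b \<in> carrier R" "t \<in> carrier R" "t \<notin> Q" "t \<otimes> b \<in> I"
    by (auto simp: sat_def)
  have "(s \<otimes> t) \<otimes> (a \<oplus> b) = t \<otimes> (s \<otimes> a) \<oplus> s \<otimes> (t \<otimes> b)" using s t by algebra
  then have "(s \<otimes> t) \<otimes> (a \<oplus> b) \<in> I"
    using ideal_add[OF I] ideal.I_l_closed[OF I] s t by simp
  then show "a \<oplus> b \<in> sat I Q" using s t prime_mult_notin[OF Q] unfolding sat_def by blast
qed (auto simp: sat_def)

lemma sat_subset_prime:
  assumes "primeideal Q R" "I \<subseteq> Q"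
  shows "sat I Q \<subseteq> Q"
  using prime_mult_notin[OF assms(1)] assms(2) by (auto simp: sat_def)

text \<open>A product of elements, one from each ideal, lies in every ideal of the family but not in a
  prime that contains none of them.\<close>
lemma exists_mem_Inter_notin_prime:
  assumes "finite F" "\<And>K. K \<in> F \<Longrightarrow> ideal K R \<and> \<not> K \<subseteq> P"
    and P: "primeideal P R" and J: "ideal J R" "\<not> J \<subseteq> P"
  shows "\<exists>y \<in> J. y \<notin> P \<and> (\<forall>K \<in> F. y \<in> K)"
  using assms(1,2)
proof (induction F)
  case empty
  then show ?case using J by blast
next
  case (insert K F)
  then obtain y where y: "y \<in> J" "y \<notin> P" "\<forall>K \<in> F. y \<in> K" by blast
  from insert.prems obtain a where a: "a \<in> K" "a \<notin> P" and K: "ideal K R" by blast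
  have carr: "a \<in> carrier R" "y \<in> carrier R" using a y K J ideal_carrier by auto
  have "a \<otimes> y \<notin> P" using primeideal.I_prime[OF P] carr a y by blast
  moreover have "a \<otimes> y \<in> J" using ideal.I_l_closed[OF J(1)] carr y by blast
  moreover have "a \<otimes> y \<in> K" using ideal.I_r_closed[OF K] carr a by blast
  moreover have "a \<otimes> y \<in> L" if "L \<in> F" for L
    using that insert.prems y carr ideal.I_l_closed[of L R y a] by blast
  ultimately show ?case by blast
qed

text \<open>Primes contained in another member of \<open>F\<close> may be dropped. In an antichain of primes, an element
  of \<open>J\<close> that avoids all but one prime \<open>P\<close> is corrected by an element that lies in \<open>J\<close> and in all the
  other primes, but not in \<open>P\<close>.\<close>
lemma prime_avoidance:
  assumes "finite F" "\<And>P. P \<in> F \<Longrightarrow> primeideal P R \<and> \<not> J \<subseteq> P"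
    and J: "ideal J R"
  shows "\<exists>x \<in> J. \<forall>P \<in> F. x \<notin> P"
  using assms(1,2)
proof (induction F rule: finite_psubset_induct)
  case (psubset F)
  show ?case
  proof (cases "\<exists>P \<in> F. \<exists>P' \<in> F. P \<noteq> P' \<and> P \<subseteq> P'")
    case True
    then obtain P P' where P: "P \<in> F" "P' \<in> F" "P \<noteq> P'" "P \<subseteq> P'" by blast
    then have "F - {P} \<subset> F" by blast
    from psubset.IH[OF this] psubset.prems obtain x where "x \<in> J" "\<forall>Q \<in> F - {P}. x \<notin> Q" by blast
    with P show ?thesis by blast
  next
    case antichain: False
    show ?thesis
    proof (cases "F = {}")
      case True
      then show ?thesis using ideal_zero[OF J] by blast
    next
      case False
      then obtain P where P: "P \<in> F" by blast
      then have "F - {P} \<subset> F" by blast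
      from psubset.IH[OF this] psubset.prems obtain x
        where x: "x \<in> J" "\<forall>Q \<in> F - {P}. x \<notin> Q" by blast
      show ?thesis
      proof (cases "x \<in> P")
        case False
        with x show ?thesis by blast
      next
        case True
        have "\<exists>y \<in> J. y \<notin> P \<and> (\<forall>K \<in> F - {P}. y \<in> K)"
          using psubset.hyps psubset.prems P antichain J
          by (intro exists_mem_Inter_notin_prime) (auto simp: primeideal.axioms(1))
        then obtain y where y: "y \<in> J" "y \<notin> P" "\<forall>K \<in> F - {P}. y \<in> K" by blast
        have carr: "x \<in> carrier R" "y \<in> carrier R" using x y J ideal_carrier by auto
        have "x \<oplus> y \<notin> Q" if Q: "Q \<in> F" for Q
        proof
          assume xy: "x \<oplus> y \<in> Q"
          have ideal: "ideal Q R" using psubset.prems Q by (simp add: primeideal.axioms(1))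
          show False
          proof (cases "Q = P")
            case True
            then show False using ideal_cancel[OF ideal xy] \<open>x \<in> P\<close> carr y by blast
          next
            case False
            then have "y \<in> Q" "x \<notin> Q" using x y Q by auto
            then show False
              using ideal_cancel[OF ideal, of y x] xy a_comm[of x y] carr by simp
          qed
        qed
        then show ?thesis using ideal_add[OF J] x y by blast
      qed
    qed
  qed
qed

end

context noetherian_cring
begin

lemma exists_maximal_among_ideals:
  assumes "C \<noteq> {}" "\<And>I. I \<in> C \<Longrightarrow> ideal I R"
  shows "\<exists>M \<in> C. \<forall>J \<in> C. M \<subseteq> J \<longrightarrow> J = M"
proof (rule subset_Zorn_nonempty[OF assms(1)])
  fix D assume D: "D \<noteq> {}" "subset.chain C D"
  then have "subset.chain {I. ideal I R} D"
    using assms(2) by (auto simp: pred_on.chain_def)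
  with D have "\<Union>D \<in> D" using ideal_chain_is_trivial by blast
  with D show "\<Union>D \<in> C" by (auto simp: pred_on.chain_def)
qed

text \<open>A maximal element among the proper ideals \<open>colon I u\<close> above \<open>colon I v\<close> is prime.\<close>
lemma exists_ass_above_colon:
  assumes I: "ideal I R" and v: "v \<in> carrier R" "v \<notin> I"
  shows "\<exists>P \<in> ass I. colon I v \<subseteq> P"
proof -
  define C where "C = {colon I u | u. u \<in> carrier R \<and> u \<notin> I \<and> colon I v \<subseteq> colon I u}"
  have "C \<noteq> {}" using v unfolding C_def by blast
  moreover have "ideal K R" if "K \<in> C" for K using that colon_ideal[OF I] by (auto simp: C_def)
  ultimately have "\<exists>M \<in> C. \<forall>K \<in> C. M \<subseteq> K \<longrightarrow> K = M" by (rule exists_maximal_among_ideals)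
  then obtain M where M: "M \<in> C" and max: "\<And>K. K \<in> C \<Longrightarrow> M \<subseteq> K \<Longrightarrow> K = M" by blast
  from M obtain u where u: "u \<in> carrier R" "u \<notin> I" "colon I v \<subseteq> colon I u" "M = colon I u"
    by (auto simp: C_def)
  have "primeideal M R"
  proof (rule primeidealI)
    show "ideal M R" using u colon_ideal[OF I] by simp
    show "cring R" by (rule is_cring)
    have "\<one> \<notin> M" using u by (simp add: colon_def)
    then show "carrier R \<noteq> M" by auto
    fix a b assume ab: "a \<in> carrier R" "b \<in> carrier R" "a \<otimes> b \<in> M"
    show "a \<in> M \<or> b \<in> M"
    proof (rule disjCI)
      assume "b \<notin> M"
      then have bu: "b \<otimes> u \<notin> I" using u ab by (simp add: colon_def)
      have sub: "M \<subseteq> colon I (b \<otimes> u)"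
      proof
        fix r assume "r \<in> M"
        then have r: "r \<in> carrier R" "r \<otimes> u \<in> I" using u by (auto simp: colon_def)
        have "r \<otimes> (b \<otimes> u) = b \<otimes> (r \<otimes> u)" using r ab u(1) by algebra
        then show "r \<in> colon I (b \<otimes> u)"
          using r ab ideal.I_l_closed[OF I] by (simp add: colon_def)
      qed
      then have "colon I (b \<otimes> u) = M"
        using u ab bu by (intro max) (auto simp: C_def)
      then show "a \<in> M"
        using ab u by (auto simp: colon_def m_assoc)
    qed
  qed
  then show ?thesis using u by (auto simp: ass_def)
qed

lemma nzd_mod_iff_notin_ass:
  assumes I: "ideal I R" and x: "x \<in> carrier R"
  shows "nzd_mod I x \<longleftrightarrow> (\<forall>P \<in> ass I. x \<notin> P)"
proof
  assume nzd: "nzd_mod I x"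
  show "\<forall>P \<in> ass I. x \<notin> P"
  proof (intro ballI notI)
    fix P assume P: "P \<in> ass I" "x \<in> P"
    then obtain v where v: "v \<in> carrier R" "P = colon I v" by (auto simp: ass_def)
    with P nzd have "v \<in> I" by (auto simp: colon_def nzd_mod_def)
    then have "\<one> \<in> P" using v by (simp add: colon_def)
    then show False using prime_proper assD(1)[OF P(1)] by blast
  qed
next
  assume avoid: "\<forall>P \<in> ass I. x \<notin> P"
  have "b \<in> I" if "b \<in> carrier R" "x \<otimes> b \<in> I" for b
    using exists_ass_above_colon[OF I that(1)] that x avoid by (auto simp: colon_def)
  then show "nzd_mod I x" using x by (simp add: nzd_mod_def)
qed

text \<open>Noetherian induction: for an associated prime \<open>colon I u\<close>, every other associated prime of
  \<open>I\<close> is also associated to the larger ideal \<open>adjoin I u\<close>.\<close>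
lemma finite_ass:
  assumes "ideal I R"
  shows "finite (ass I)"
proof (rule ccontr)
  assume "infinite (ass I)"
  then have "{I. ideal I R \<and> infinite (ass I)} \<noteq> {}" using assms by blast
  then have "\<exists>I \<in> {I. ideal I R \<and> infinite (ass I)}.
      \<forall>J \<in> {I. ideal I R \<and> infinite (ass I)}. I \<subseteq> J \<longrightarrow> J = I"
    by (rule exists_maximal_among_ideals) simp
  then obtain I where I: "ideal I R" and inf: "infinite (ass I)"
    and max: "\<And>J. ideal J R \<Longrightarrow> infinite (ass J) \<Longrightarrow> I \<subseteq> J \<Longrightarrow> J = I"
    by blast
  from inf obtain P where P: "P \<in> ass I" by (metis ex_in_conv finite.emptyI)
  then obtain u where u: "u \<in> carrier R" "P = colon I u" by (auto simp: ass_def)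
  let ?J = "adjoin I u"
  note carr = ideal_carrier[OF I]
  have J: "ideal ?J R" "I \<subseteq> ?J" using I u adjoin_ideal adjoin_superset by auto
  have "u \<notin> I" using prime_proper[OF assD(1)[OF P]] u by (auto simp: colon_def)
  then have "?J \<noteq> I" using adjoin_superset(2)[OF I u(1)] by blast
  then have fin: "finite (ass ?J)" using max J by blast
  have "Q \<in> insert P (ass ?J)" if Q: "Q \<in> ass I" for Q
  proof -
    obtain v where v: "v \<in> carrier R" "Q = colon I v" using Q by (auto simp: ass_def)
    note primeQ = assD(1)[OF Q] and primeP = assD(1)[OF P]
    show ?thesis
    proof (cases "colon ?J v \<subseteq> Q")
      case True
      then have "Q = colon ?J v" using v J(2) by (auto simp: colon_def)
      then show ?thesis using primeQ v by (auto simp: ass_def)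
    next
      \<comment> \<open>A multiple of \<open>v\<close> outside \<open>I\<close> is congruent to a multiple of \<open>u\<close>. The primes \<open>Q\<close> and \<open>P\<close> are
        the annihilators modulo \<open>I\<close> of these two multiples, so that they agree.\<close>
      case False
      then obtain r where r: "r \<in> carrier R" "r \<otimes> v \<in> ?J" "r \<notin> Q" by (auto simp: colon_def)
      then obtain i s where s: "i \<in> I" "s \<in> carrier R" "r \<otimes> v = i \<oplus> s \<otimes> u"
        by (auto simp: adjoin_def)
      have eq: "t \<otimes> (r \<otimes> v) \<in> I \<longleftrightarrow> t \<otimes> (s \<otimes> u) \<in> I" if t: "t \<in> carrier R" for t
      proof -
        have dist: "t \<otimes> (r \<otimes> v) = t \<otimes> i \<oplus> t \<otimes> (s \<otimes> u)"
          using s carr[OF s(1)] u t by (simp add: r_distr)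
        have ti: "t \<otimes> i \<in> I" using ideal.I_l_closed[OF I] s t by blast
        show ?thesis
          using ideal_cancel[OF I _ ti, of "t \<otimes> (s \<otimes> u)"] ideal_add[OF I ti] t s u
          unfolding dist by auto
      qed
      have "r \<otimes> v \<notin> I" using r v by (auto simp: colon_def)
      then have "s \<otimes> u \<notin> I"
        using eq[of \<one>] r(1) v(1) s(2) u(1) by (metis l_one m_closed one_closed)
      then have "s \<notin> P" using s u by (simp add: colon_def)
      have "t \<in> Q \<longleftrightarrow> t \<otimes> (r \<otimes> v) \<in> I" if t: "t \<in> carrier R" for t
      proof -
        have "t \<otimes> (r \<otimes> v) = (t \<otimes> r) \<otimes> v" using t r v by (simp add: m_assoc)
        then have "t \<otimes> (r \<otimes> v) \<in> I \<longleftrightarrow> t \<otimes> r \<in> Q" using v t r by (simp add: colon_def)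
        then show ?thesis
          using primeideal.I_prime[OF primeQ t r(1)] r t
            ideal.I_r_closed[OF assD(2)[OF Q]] by blast
      qed
      moreover have "t \<in> P \<longleftrightarrow> t \<otimes> (s \<otimes> u) \<in> I" if t: "t \<in> carrier R" for t
      proof -
        have "t \<otimes> (s \<otimes> u) = (t \<otimes> s) \<otimes> u" using t s u by (simp add: m_assoc)
        then have "t \<otimes> (s \<otimes> u) \<in> I \<longleftrightarrow> t \<otimes> s \<in> P" using u t s by (simp add: colon_def)
        then show ?thesis
          using primeideal.I_prime[OF primeP t s(2)] \<open>s \<notin> P\<close> s t
            ideal.I_r_closed[OF assD(2)[OF P]] by blast
      qed
      ultimately have "Q = P"
        using eq ideal_carrier[OF assD(2)[OF P]] ideal_carrier[OF assD(2)[OF Q]] by blast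
      then show ?thesis by simp
    qed
  qed
  then have "ass I \<subseteq> insert P (ass ?J)" by blast
  then show False using inf fin finite_subset by blast
qed

text \<open>An associated prime of \<open>sat I Q\<close> is the annihilator of some \<open>v\<close> modulo \<open>sat I Q\<close>. Being finitely
  generated, it annihilates \<open>s \<otimes> v\<close> modulo \<open>I\<close> for some \<open>s\<close> outside \<open>Q\<close>.\<close>
lemma ass_sat:
  assumes I: "ideal I R" and Q: "primeideal Q R" and P: "P \<in> ass (sat I Q)"
  shows "P \<in> ass I" "P \<subseteq> Q"
proof -
  obtain v where v: "v \<in> carrier R" "P = colon (sat I Q) v" using P by (auto simp: ass_def)
  have "v \<notin> sat I Q" using prime_proper[OF assD(1)[OF P]] v by (auto simp: colon_def)
  show "P \<subseteq> Q"
  proof (rule subsetI, rule ccontr)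
    fix t assume t: "t \<in> P" "t \<notin> Q"
    then obtain s where s: "t \<in> carrier R" "s \<in> carrier R" "s \<notin> Q" "s \<otimes> (t \<otimes> v) \<in> I"
      using v by (auto simp: colon_def sat_def)
    then have "v \<in> sat I Q" using prime_mult_notin[OF Q, of s t] t v m_assoc[of s t v] by (auto simp: sat_def)
    with \<open>v \<notin> sat I Q\<close> show False by blast
  qed
  obtain A where A: "A \<subseteq> carrier R" "finite A" "P = Idl A"
    using finetely_gen assD(2)[OF P] by blast
  then have AP: "A \<subseteq> P" using genideal_self by blast
  from A(2) AP have "\<exists>s \<in> carrier R. s \<notin> Q \<and> (\<forall>a \<in> A. s \<otimes> (a \<otimes> v) \<in> I)"
  proof (induction A)
    case empty
    then show ?case using prime_proper[OF Q] by auto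
  next
    case (insert a A)
    then obtain s where s: "s \<in> carrier R" "s \<notin> Q" "\<forall>a \<in> A. s \<otimes> (a \<otimes> v) \<in> I" by blast
    from insert.prems v obtain t where t: "a \<in> carrier R" "t \<in> carrier R" "t \<notin> Q" "t \<otimes> (a \<otimes> v) \<in> I"
      by (auto simp: colon_def sat_def)
    have "(s \<otimes> t) \<otimes> (b \<otimes> v) \<in> I" if b: "b \<in> insert a A" for b
    proof -
      have bc: "b \<in> carrier R" using b insert.prems assD(2)[OF P] ideal_carrier by blast
      have "(s \<otimes> t) \<otimes> (b \<otimes> v) = s \<otimes> (t \<otimes> (b \<otimes> v))"
        "(s \<otimes> t) \<otimes> (b \<otimes> v) = t \<otimes> (s \<otimes> (b \<otimes> v))"
        using s t bc v(1) by algebra+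
      then show ?thesis using b s t ideal.I_l_closed[OF I] by (metis insertE)
    qed
    then show ?case using prime_mult_notin[OF Q] s t by blast
  qed
  then obtain s where s: "s \<in> carrier R" "s \<notin> Q" "\<forall>a \<in> A. s \<otimes> (a \<otimes> v) \<in> I" by blast
  have "P \<subseteq> colon I (s \<otimes> v)"
    unfolding A(3)
  proof (rule genideal_minimal)
    show "ideal (colon I (s \<otimes> v)) R" using colon_ideal I s v by simp
    have "a \<otimes> (s \<otimes> v) = s \<otimes> (a \<otimes> v)" if "a \<in> A" for a
      using that A(1) s v(1) m_lcomm by blast
    then show "A \<subseteq> colon I (s \<otimes> v)" using s A(1) by (auto simp: colon_def)
  qed
  moreover have "colon I (s \<otimes> v) \<subseteq> P"
  proof
    fix t assume "t \<in> colon I (s \<otimes> v)"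
    then have t: "t \<in> carrier R" "t \<otimes> (s \<otimes> v) \<in> I" by (auto simp: colon_def)
    then have "s \<otimes> (t \<otimes> v) \<in> I" using m_lcomm[of t s v] s v by simp
    then show "t \<in> P" using t s v by (auto simp: colon_def sat_def)
  qed
  ultimately show "P \<in> ass I" using assD(1)[OF P] s v by (auto simp: ass_def)
qed

lemma exists_ass_below_prime:
  assumes I: "ideal I R" and Q: "primeideal Q R" "I \<subseteq> Q"
  shows "\<exists>P \<in> ass I. P \<subseteq> Q"
proof -
  have "\<one> \<notin> sat I Q" using sat_subset_prime[OF Q] prime_proper[OF Q(1)] by blast
  then obtain P where "P \<in> ass (sat I Q)"
    using exists_ass_above_colon[OF sat_ideal[OF I Q(1)] one_closed] by blast
  then show ?thesis using ass_sat[OF I Q(1)] by blast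
qed

lemma minimal_over_imp_ass:
  assumes "ideal I R" "primeideal Q R" "I \<subseteq> Q"
    and "\<And>P. primeideal P R \<Longrightarrow> I \<subseteq> P \<Longrightarrow> P \<subseteq> Q \<Longrightarrow> P = Q"
  shows "Q \<in> ass I"
  using exists_ass_below_prime[OF assms(1-3)] assms(4) assD(1) ass_superset[OF assms(1)] by metis

end

section \<open>Regular sequences in noetherian local rings\<close>

sublocale noetherian_local_ring \<subseteq> noetherian_cring R
  by (rule noetherian_cring.intro[OF is_cring noetherian_ring_axioms])

context noetherian_local_ring
begin

lemma mm_prime: "primeideal \<mm> R"
  by (rule maximalideal_prime[OF maximal])

lemma mm_ideal: "ideal \<mm> R"
  by (rule primeideal.axioms(1)[OF mm_prime])

lemma proper_ideal_subset_mm: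
  assumes I: "ideal I R" "\<one> \<notin> I"
  shows "I \<subseteq> \<mm>"
proof -
  define C where "C = {J. ideal J R \<and> I \<subseteq> J \<and> \<one> \<notin> J}"
  have "C \<noteq> {}" using I by (auto simp: C_def)
  then have "\<exists>M \<in> C. \<forall>J \<in> C. M \<subseteq> J \<longrightarrow> J = M"
    by (rule exists_maximal_among_ideals) (auto simp: C_def)
  then obtain M where M: "M \<in> C" "\<And>J. J \<in> C \<Longrightarrow> M \<subseteq> J \<Longrightarrow> J = M" by blast
  have "maximalideal M R"
  proof (rule maximalidealI)
    show "ideal M R" "carrier R \<noteq> M" using M(1) by (auto simp: C_def)
    show "J = M \<or> J = carrier R" if "ideal J R" "M \<subseteq> J" "J \<subseteq> carrier R" for J
    proof (cases "\<one> \<in> J")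
      case True
      then show ?thesis using ideal.one_imp_carrier that by blast
    next
      case False
      then have "J \<in> C" using that M(1) by (auto simp: C_def)
      then show ?thesis using M(2) that by blast
    qed
  qed
  then show ?thesis using M(1) unique by (auto simp: C_def)
qed

lemma prime_subset_mm: "primeideal P R \<Longrightarrow> P \<subseteq> \<mm>"
  using proper_ideal_subset_mm prime_proper primeideal.axioms(1) by blast

text \<open>Nakayama's lemma for the module \<open>U / I\<close>. Choose \<open>u\<close> in \<open>U\<close> outside \<open>I\<close> such that \<open>adjoin I u\<close>
  is maximal. Modulo \<open>I\<close>, the element \<open>u\<close> is some \<open>x \<otimes> u'\<close>, and by maximality \<open>u'\<close> is a multiple
  \<open>r \<otimes> u\<close>. Hence the unit \<open>\<one> \<ominus> x \<otimes> r\<close> kills \<open>u\<close> modulo \<open>I\<close>.\<close>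
lemma nakayama:
  assumes I: "ideal I R" and U: "ideal U R" "I \<subseteq> U" and x: "x \<in> \<mm>"
    and div: "\<And>u. u \<in> U \<Longrightarrow> \<exists>i \<in> I. \<exists>u' \<in> U. u = i \<oplus> x \<otimes> u'"
  shows "U \<subseteq> I"
proof (rule ccontr)
  assume "\<not> U \<subseteq> I"
  define C where "C = {adjoin I u | u. u \<in> U \<and> u \<notin> I}"
  have xc: "x \<in> carrier R" using x ideal_carrier mm_ideal by blast
  note carrI = ideal_carrier[OF I] and carrU = ideal_carrier[OF U(1)]
  have "C \<noteq> {}" using \<open>\<not> U \<subseteq> I\<close> by (auto simp: C_def)
  moreover have "ideal K R" if "K \<in> C" for K
    using that adjoin_ideal[OF I] carrU by (auto simp: C_def)
  ultimately have "\<exists>M \<in> C. \<forall>K \<in> C. M \<subseteq> K \<longrightarrow> K = M" by (rule exists_maximal_among_ideals)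
  then obtain M where M: "M \<in> C" and max: "\<And>K. K \<in> C \<Longrightarrow> M \<subseteq> K \<Longrightarrow> K = M" by blast
  then obtain u where u: "u \<in> U" "u \<notin> I" "M = adjoin I u" by (auto simp: C_def)
  obtain i u' where u': "i \<in> I" "u' \<in> U" "u = i \<oplus> x \<otimes> u'" using div[OF u(1)] by blast
  have c: "i \<in> carrier R" "u' \<in> carrier R" "u \<in> carrier R" using u u' carrI carrU by auto
  have "u' \<notin> I"
    using u u' ideal_add[OF I] ideal.I_l_closed[OF I _ xc] by blast
  moreover have "adjoin I u \<subseteq> adjoin I u'"
  proof (rule adjoin_least)
    show ideal: "ideal (adjoin I u') R" using adjoin_ideal I c by simp
    show "I \<subseteq> adjoin I u'" using adjoin_superset I c by simp
    show "u \<in> adjoin I u'" using u' xc unfolding adjoin_def by blast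
  qed
  ultimately have "adjoin I u' = adjoin I u" using max u u' by (auto simp: C_def)
  then have "u' \<in> adjoin I u" using adjoin_superset(2)[OF I c(2)] by simp
  then obtain j r where j: "j \<in> I" "r \<in> carrier R" "u' = j \<oplus> r \<otimes> u" by (auto simp: adjoin_def)
  have jc: "j \<in> carrier R" using j carrI by blast
  let ?e = "\<one> \<ominus> x \<otimes> r"
  have ec: "?e \<in> carrier R" using xc j by simp
  have "i \<oplus> x \<otimes> j \<in> I" using ideal_add[OF I u'(1)] ideal.I_l_closed[OF I j(1) xc] by blast
  moreover have "?e \<otimes> u = i \<oplus> x \<otimes> j"
  proof -
    have "u = i \<oplus> x \<otimes> (j \<oplus> r \<otimes> u)" by (rule u'(3)[unfolded j(3)])
    then have "u \<ominus> (x \<otimes> r) \<otimes> u = (i \<oplus> x \<otimes> (j \<oplus> r \<otimes> u)) \<ominus> (x \<otimes> r) \<otimes> u"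
      by (rule arg_cong)
    moreover have "(i \<oplus> x \<otimes> (j \<oplus> r \<otimes> u)) \<ominus> (x \<otimes> r) \<otimes> u = i \<oplus> x \<otimes> j"
      using c jc xc j(2) by algebra
    moreover have "?e \<otimes> u = u \<ominus> (x \<otimes> r) \<otimes> u" using c xc j(2) by algebra
    ultimately show ?thesis by simp
  qed
  ultimately have eu: "?e \<otimes> u \<in> I" by simp
  have eI: "ideal (PIdl ?e) R" using cgenideal_ideal ec by simp
  have "\<one> \<in> PIdl ?e"
  proof (rule ccontr)
    assume "\<one> \<notin> PIdl ?e"
    then have "?e \<in> \<mm>" using proper_ideal_subset_mm[OF eI] cgenideal_self[OF ec] by blast
    moreover have "x \<otimes> r \<in> \<mm>" using ideal.I_r_closed[OF mm_ideal x j(2)] .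
    ultimately have "?e \<oplus> x \<otimes> r \<in> \<mm>" by (rule ideal_add[OF mm_ideal])
    moreover have "?e \<oplus> x \<otimes> r = \<one>" using xc j by algebra
    ultimately show False using prime_proper[OF mm_prime] by simp
  qed
  then obtain t where t: "t \<in> carrier R" "\<one> = t \<otimes> ?e" by (auto simp: cgenideal_def)
  then have "t \<otimes> (?e \<otimes> u) = u" using ec c by (metis l_one m_assoc)
  then show False using ideal.I_l_closed[OF I eu t(1)] u by simp
qed

text \<open>By Nakayama's lemma, some element \<open>u\<close> annihilated by \<open>P\<close> modulo \<open>I\<close> lies outside
  \<open>adjoin I x\<close>. Both \<open>P\<close> and \<open>x\<close> annihilate it modulo \<open>adjoin I x\<close>, and \<open>x\<close> is not in \<open>P\<close>.\<close>
lemma ass_strictly_increases: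
  assumes I: "ideal I R" and P: "P \<in> ass I" and x: "x \<in> \<mm>" "nzd_mod I x"
  shows "\<exists>Q \<in> ass (adjoin I x). P \<subset> Q"
proof -
  have xc: "x \<in> carrier R" using x ideal_carrier mm_ideal by blast
  obtain v where v: "v \<in> carrier R" "P = colon I v" using P by (auto simp: ass_def)
  have Pc: "p \<in> carrier R" if "p \<in> P" for p using that ideal_carrier assD(2)[OF P] by blast
  define U where "U = {u \<in> carrier R. \<forall>p \<in> P. p \<otimes> u \<in> I}"
  have U: "ideal U R"
  proof (rule idealI_elementwise)
    show "\<zero> \<in> U" using Pc ideal_zero[OF I] by (auto simp: U_def)
    fix a assume a: "a \<in> U"
    show "a \<oplus> b \<in> U" if b: "b \<in> U" for b
      using a b Pc ideal_add[OF I] by (auto simp: U_def r_distr)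
    show "r \<otimes> a \<in> U" if r: "r \<in> carrier R" for r
      using a r Pc ideal.I_l_closed[OF I] m_lcomm[of _ r a] by (auto simp: U_def)
  qed (auto simp: U_def)
  have IU: "I \<subseteq> U"
    using ideal.I_l_closed[OF I] Pc ideal_carrier[OF I] by (auto simp: U_def)
  have "\<not> U \<subseteq> adjoin I x"
  proof
    assume sub: "U \<subseteq> adjoin I x"
    have "U \<subseteq> I"
    proof (rule nakayama[OF I U IU x(1)])
      fix u assume u: "u \<in> U"
      then obtain i y where y: "i \<in> I" "y \<in> carrier R" "u = i \<oplus> y \<otimes> x"
        using sub by (auto simp: adjoin_def)
      have ic: "i \<in> carrier R" using y ideal_carrier[OF I] by blast
      have "p \<otimes> y \<in> I" if p: "p \<in> P" for p
      proof -
        have pc: "p \<in> carrier R" using Pc p by blast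
        have "p \<otimes> u \<in> I" using u p by (simp add: U_def)
        moreover have "p \<otimes> u = p \<otimes> i \<oplus> x \<otimes> (p \<otimes> y)" unfolding y(3) using pc ic y(2) xc by algebra
        moreover have "p \<otimes> i \<in> I" using ideal.I_l_closed[OF I y(1) pc] .
        ultimately have "x \<otimes> (p \<otimes> y) \<in> I"
          using ideal_cancel[OF I, of "p \<otimes> i" "x \<otimes> (p \<otimes> y)"] pc y xc by simp
        then show ?thesis using x pc y by (simp add: nzd_mod_def)
      qed
      then have "y \<in> U" using y by (simp add: U_def)
      moreover have "u = i \<oplus> x \<otimes> y" using y xc by (simp add: m_comm)
      ultimately show "\<exists>i \<in> I. \<exists>u' \<in> U. u = i \<oplus> x \<otimes> u'" using y by blast
    qed
    moreover have "v \<in> U" using v by (auto simp: U_def colon_def)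
    ultimately have "\<one> \<in> P" using v by (auto simp: colon_def)
    then show False using prime_proper assD(1)[OF P] by blast
  qed
  then obtain u where u: "u \<in> U" "u \<notin> adjoin I x" by blast
  then have uc: "u \<in> carrier R" by (simp add: U_def)
  have J: "ideal (adjoin I x) R" "I \<subseteq> adjoin I x" "x \<in> adjoin I x"
    using adjoin_ideal adjoin_superset I xc by auto
  obtain Q where Q: "Q \<in> ass (adjoin I x)" "colon (adjoin I x) u \<subseteq> Q"
    using exists_ass_above_colon[OF J(1) uc u(2)] by blast
  have "P \<subseteq> colon (adjoin I x) u" using u J(2) Pc by (auto simp: U_def colon_def)
  moreover have "x \<in> Q" using J(3) ass_superset[OF J(1) Q(1)] by blast
  moreover have "x \<notin> P" using nzd_mod_iff_notin_ass[OF I xc] x P by blast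
  ultimately show ?thesis using Q by blast
qed

primrec adjoin_list :: "'a set \<Rightarrow> 'a list \<Rightarrow> 'a set" where
  "adjoin_list I [] = I"
| "adjoin_list I (x # xs) = adjoin_list (adjoin I x) xs"

text \<open>Only elements of the maximal ideal are admitted, so that \<open>adjoin_list I xs\<close> is proper whenever
  \<open>I\<close> is.\<close>
primrec regseq :: "'a set \<Rightarrow> 'a list \<Rightarrow> bool" where
  "regseq I [] \<longleftrightarrow> True"
| "regseq I (x # xs) \<longleftrightarrow> x \<in> \<mm> \<and> nzd_mod I x \<and> regseq (adjoin I x) xs"

lemma adjoin_list_append: "adjoin_list I (xs @ ys) = adjoin_list (adjoin_list I xs) ys"
  by (induction xs arbitrary: I) auto

lemma regseq_append: "regseq I (xs @ ys) \<longleftrightarrow> regseq I xs \<and> regseq (adjoin_list I xs) ys"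
  by (induction xs arbitrary: I) auto

lemma regseq_set: "regseq I xs \<Longrightarrow> set xs \<subseteq> \<mm>"
  by (induction xs arbitrary: I) auto

lemma mm_carrier: "x \<in> \<mm> \<Longrightarrow> x \<in> carrier R"
  using ideal_carrier mm_ideal by blast

lemma adjoin_list_ideal: "ideal I R \<Longrightarrow> set xs \<subseteq> \<mm> \<Longrightarrow> ideal (adjoin_list I xs) R"
  by (induction xs arbitrary: I) (auto simp: adjoin_ideal mm_carrier)

lemma adjoin_list_subset_mm: "I \<subseteq> \<mm> \<Longrightarrow> set xs \<subseteq> \<mm> \<Longrightarrow> adjoin_list I xs \<subseteq> \<mm>"
  by (induction xs arbitrary: I) (auto simp: adjoin_least mm_ideal)

lemma adjoin_list_adjoin:
  "ideal I R \<Longrightarrow> set xs \<subseteq> \<mm> \<Longrightarrow> w \<in> carrier R \<Longrightarrow>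
    adjoin_list (adjoin I w) xs = adjoin (adjoin_list I xs) w"
  by (induction xs arbitrary: I) (auto simp: adjoin_ideal mm_carrier adjoin_commute)

text \<open>If \<open>w\<close> kills \<open>u\<close> modulo \<open>I\<close>, then \<open>u\<close> is a multiple of \<open>x\<close> modulo \<open>I\<close>, and \<open>w\<close> also kills the
  cofactor. By Nakayama's lemma, nothing outside \<open>I\<close> is killed.\<close>
lemma nzd_mod_swap:
  assumes I: "ideal I R" and x: "x \<in> \<mm>" "nzd_mod I x" and w: "w \<in> carrier R" "nzd_mod (adjoin I x) w"
  shows "nzd_mod I w" "nzd_mod (adjoin I w) x"
proof -
  have xc: "x \<in> carrier R" using x mm_carrier by blast
  note carrI = ideal_carrier[OF I]
  have J: "I \<subseteq> adjoin I x" using adjoin_superset(1)[OF I xc] .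
  have sub: "colon I w \<subseteq> I"
  proof (rule nakayama[OF I colon_ideal[OF I w(1)] colon_superset[OF I w(1)] x(1)])
    fix u assume "u \<in> colon I w"
    then have u: "u \<in> carrier R" "w \<otimes> u \<in> I" using w by (auto simp: colon_def m_comm)
    then have "u \<in> adjoin I x" using w J by (auto simp: nzd_mod_def)
    then obtain i b where b: "i \<in> I" "b \<in> carrier R" "u = i \<oplus> b \<otimes> x" by (auto simp: adjoin_def)
    have ic: "i \<in> carrier R" using b carrI by blast
    have "w \<otimes> u = w \<otimes> i \<oplus> x \<otimes> (b \<otimes> w)" unfolding b(3) using ic b(2) xc w(1) by algebra
    then have "x \<otimes> (b \<otimes> w) \<in> I"
      using ideal_cancel[OF I, of "w \<otimes> i" "x \<otimes> (b \<otimes> w)"] u(2) ideal.I_l_closed[OF I b(1) w(1)]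
        xc b(2) w(1) by simp
    then have "b \<in> colon I w" using x(2) b w by (auto simp: nzd_mod_def colon_def)
    moreover have "u = i \<oplus> x \<otimes> b" using b xc by (simp add: m_comm)
    ultimately show "\<exists>i \<in> I. \<exists>u' \<in> colon I w. u = i \<oplus> x \<otimes> u'" using b by blast
  qed
  show "nzd_mod I w"
    unfolding nzd_mod_def
  proof (intro conjI ballI impI)
    fix b assume "b \<in> carrier R" "w \<otimes> b \<in> I"
    then have "b \<in> colon I w" using w by (simp add: colon_def m_comm)
    with sub show "b \<in> I" by blast
  qed (rule w(1))
  show "nzd_mod (adjoin I w) x"
    unfolding nzd_mod_def
  proof (intro conjI ballI impI)
    fix a assume a: "a \<in> carrier R" "x \<otimes> a \<in> adjoin I w"
    then obtain i b where b: "i \<in> I" "b \<in> carrier R" "x \<otimes> a = i \<oplus> b \<otimes> w"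
      by (auto simp: adjoin_def)
    have ic: "i \<in> carrier R" using b carrI by blast
    have "w \<otimes> b = (\<ominus> i) \<oplus> a \<otimes> x"
    proof -
      have "w \<otimes> b = (\<ominus> i) \<oplus> (i \<oplus> b \<otimes> w)" using ic b(2) w(1) by algebra
      then show ?thesis using b(3) a xc by (simp add: m_comm)
    qed
    moreover have "\<ominus> i \<in> I" by (rule additive_subgroup.a_inv_closed[OF ideal.axioms(1)[OF I] b(1)])
    ultimately have "w \<otimes> b \<in> adjoin I x" using a unfolding adjoin_def by blast
    then have "b \<in> adjoin I x" using w(2) b by (simp add: nzd_mod_def)
    then obtain j c where c: "j \<in> I" "c \<in> carrier R" "b = j \<oplus> c \<otimes> x" by (auto simp: adjoin_def)
    have jc: "j \<in> carrier R" using c carrI by blast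
    have "x \<otimes> (a \<ominus> c \<otimes> w) = i \<oplus> j \<otimes> w"
    proof -
      have "x \<otimes> (a \<ominus> c \<otimes> w) = x \<otimes> a \<ominus> c \<otimes> x \<otimes> w" using a(1) c(2) w(1) xc by algebra
      also have "\<dots> = i \<oplus> j \<otimes> w" unfolding b(3) c(3) using ic jc c(2) w(1) xc by algebra
      finally show ?thesis .
    qed
    then have "x \<otimes> (a \<ominus> c \<otimes> w) \<in> I"
      using ideal_add[OF I b(1)] ideal.I_r_closed[OF I c(1) w(1)] by simp
    then have "a \<ominus> c \<otimes> w \<in> I" using x(2) a c w by (simp add: nzd_mod_def)
    moreover have "a = (a \<ominus> c \<otimes> w) \<oplus> c \<otimes> w" using a(1) c(2) w(1) by algebra
    ultimately show "a \<in> adjoin I w" using c unfolding adjoin_def by blast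
  qed (rule xc)
qed

lemma regseq_rotate:
  "ideal I R \<Longrightarrow> regseq I xs \<Longrightarrow> w \<in> carrier R \<Longrightarrow> nzd_mod (adjoin_list I xs) w \<Longrightarrow>
    nzd_mod I w \<and> regseq (adjoin I w) xs"
proof (induction xs arbitrary: I)
  case (Cons x xs)
  from Cons.prems(2) have x: "x \<in> \<mm>" "nzd_mod I x" "x \<in> carrier R"
    by (simp_all add: mm_carrier)
  have "nzd_mod (adjoin I x) w \<and> regseq (adjoin (adjoin I x) w) xs"
    using Cons.prems x by (intro Cons.IH) (simp_all add: adjoin_ideal)
  then have IH: "nzd_mod (adjoin I x) w" "regseq (adjoin (adjoin I x) w) xs" by auto
  then show ?case
    using nzd_mod_swap[OF Cons.prems(1) x(1,2) Cons.prems(3) IH(1)] x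
      adjoin_commute[OF Cons.prems(1) x(3) Cons.prems(3)] by simp
qed simp

text \<open>Let \<open>z\<close> be outside \<open>adjoin I x\<close> with \<open>\<mm> z \<subseteq> adjoin I x\<close>, and write \<open>y z = x w\<close> modulo \<open>I\<close>.
  Cancelling \<open>x\<close> gives \<open>\<mm> w \<subseteq> adjoin I y\<close>; and \<open>w\<close> is outside \<open>adjoin I y\<close>, since otherwise
  cancelling \<open>y\<close> would put \<open>z\<close> into \<open>adjoin I x\<close>.\<close>
lemma mm_ass_exchange:
  assumes I: "ideal I R" and x: "x \<in> \<mm>" "nzd_mod I x" and y: "y \<in> \<mm>" "nzd_mod I y"
    and mm: "\<mm> \<in> ass (adjoin I x)"
  shows "\<mm> \<in> ass (adjoin I y)"
proof -
  have c: "x \<in> carrier R" "y \<in> carrier R" using x y mm_carrier by auto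
  note carrI = ideal_carrier[OF I]
  have Jx: "ideal (adjoin I x) R" and Jy: "ideal (adjoin I y) R" using adjoin_ideal[OF I] c by auto
  obtain z where z: "z \<in> carrier R" "\<mm> = colon (adjoin I x) z" using mm by (auto simp: ass_def)
  have zn: "z \<notin> adjoin I x" using prime_proper[OF mm_prime] z by (auto simp: colon_def)
  have "y \<otimes> z \<in> adjoin I x" using y z by (auto simp: colon_def)
  then obtain i w where w: "i \<in> I" "w \<in> carrier R" "y \<otimes> z = i \<oplus> w \<otimes> x"
    by (auto simp: adjoin_def)
  have ic: "i \<in> carrier R" using w carrI by blast
  have wn: "w \<notin> adjoin I y"
  proof
    assume "w \<in> adjoin I y"
    then obtain j b where b: "j \<in> I" "b \<in> carrier R" "w = j \<oplus> b \<otimes> y" by (auto simp: adjoin_def)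
    have jc: "j \<in> carrier R" using b carrI by blast
    have "y \<otimes> (z \<ominus> b \<otimes> x) = i \<oplus> j \<otimes> x"
    proof -
      have "y \<otimes> (z \<ominus> b \<otimes> x) = y \<otimes> z \<ominus> b \<otimes> y \<otimes> x" using z(1) b(2) c by algebra
      also have "\<dots> = i \<oplus> j \<otimes> x" unfolding w(3) b(3) using ic jc b(2) c by algebra
      finally show ?thesis .
    qed
    then have "y \<otimes> (z \<ominus> b \<otimes> x) \<in> I"
      using ideal_add[OF I w(1)] ideal.I_r_closed[OF I b(1) c(1)] by simp
    then have "z \<ominus> b \<otimes> x \<in> I" using y(2) z b c by (simp add: nzd_mod_def)
    moreover have "z = (z \<ominus> b \<otimes> x) \<oplus> b \<otimes> x" using z(1) b(2) c by algebra
    ultimately have "z \<in> adjoin I x" using b unfolding adjoin_def by blast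
    with zn show False by blast
  qed
  have "\<mm> \<subseteq> colon (adjoin I y) w"
  proof
    fix t assume t: "t \<in> \<mm>"
    then have tc: "t \<in> carrier R" using mm_carrier by blast
    have "t \<otimes> z \<in> adjoin I x" using t z by (auto simp: colon_def)
    then obtain j a where a: "j \<in> I" "a \<in> carrier R" "t \<otimes> z = j \<oplus> a \<otimes> x"
      by (auto simp: adjoin_def)
    have jc: "j \<in> carrier R" using a carrI by blast
    have eq: "t \<otimes> i \<oplus> x \<otimes> (t \<otimes> w) = y \<otimes> j \<oplus> x \<otimes> (a \<otimes> y)"
    proof -
      have "t \<otimes> i \<oplus> x \<otimes> (t \<otimes> w) = t \<otimes> (y \<otimes> z)"
        unfolding w(3) using tc ic w(2) c by algebra
      also have "\<dots> = y \<otimes> (t \<otimes> z)" using tc z(1) c by algebra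
      also have "\<dots> = y \<otimes> j \<oplus> x \<otimes> (a \<otimes> y)"
        unfolding a(3) using jc a(2) c by algebra
      finally show ?thesis .
    qed
    have "x \<otimes> (t \<otimes> w \<ominus> a \<otimes> y) = y \<otimes> j \<ominus> t \<otimes> i"
    proof -
      have "x \<otimes> (t \<otimes> w \<ominus> a \<otimes> y) = (t \<otimes> i \<oplus> x \<otimes> (t \<otimes> w)) \<ominus> t \<otimes> i \<ominus> x \<otimes> (a \<otimes> y)"
        using tc ic w(2) a(2) c by algebra
      also have "\<dots> = y \<otimes> j \<ominus> t \<otimes> i" unfolding eq using tc ic jc w(2) a(2) c by algebra
      finally show ?thesis .
    qed
    then have "x \<otimes> (t \<otimes> w \<ominus> a \<otimes> y) \<in> I"
      using ideal_minus[OF I] ideal.I_l_closed[OF I] a w tc c by simp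
    then have "t \<otimes> w \<ominus> a \<otimes> y \<in> I" using x(2) tc w a c by (simp add: nzd_mod_def)
    moreover have "t \<otimes> w = (t \<otimes> w \<ominus> a \<otimes> y) \<oplus> a \<otimes> y" using tc w(2) a(2) c by algebra
    ultimately have "t \<otimes> w \<in> adjoin I y" using a unfolding adjoin_def by blast
    then show "t \<in> colon (adjoin I y) w" using tc by (simp add: colon_def)
  qed
  moreover have "colon (adjoin I y) w \<subseteq> \<mm>"
    using colon_ideal[OF Jy w(2)] wn w(2)
    by (intro proper_ideal_subset_mm) (auto simp: colon_def)
  ultimately show ?thesis using mm_prime w by (auto simp: ass_def)
qed

lemma mm_notin_ass: "ideal I R \<Longrightarrow> x \<in> \<mm> \<Longrightarrow> nzd_mod I x \<Longrightarrow> \<mm> \<notin> ass I"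
  using nzd_mod_iff_notin_ass mm_carrier by blast

lemma exists_common_nzd:
  assumes "ideal I R" "ideal J R" "\<mm> \<notin> ass I" "\<mm> \<notin> ass J"
  shows "\<exists>w \<in> \<mm>. nzd_mod I w \<and> nzd_mod J w"
proof -
  have "\<exists>w \<in> \<mm>. \<forall>P \<in> ass I \<union> ass J. w \<notin> P"
  proof (rule prime_avoidance[OF _ _ mm_ideal])
    show "finite (ass I \<union> ass J)" using finite_ass assms by blast
    show "primeideal P R \<and> \<not> \<mm> \<subseteq> P" if "P \<in> ass I \<union> ass J" for P
    proof
      show "primeideal P R" using that assD(1) by blast
      then have "P \<subseteq> \<mm>" by (rule prime_subset_mm)
      moreover have "P \<noteq> \<mm>" using that assms by blast
      ultimately show "\<not> \<mm> \<subseteq> P" by blast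
    qed
  qed
  then show ?thesis using nzd_mod_iff_notin_ass assms mm_carrier by blast
qed

text \<open>Two sequences of length \<open>n + 1\<close> are compared through a common last element \<open>w\<close>, which is exchanged
  for each of the two last elements. Regular sequences in a local ring may be permuted, so
  that \<open>w\<close> can be moved to the front, and the case of length \<open>n\<close> applies to \<open>adjoin I w\<close>.\<close>
lemma mm_ass_regseq_exchange:
  assumes "ideal I R" "regseq I xs" "regseq I ys" "length xs = length ys"
    and "\<mm> \<in> ass (adjoin_list I xs)"
  shows "\<mm> \<in> ass (adjoin_list I ys)"
  using assms
proof (induction "length xs" arbitrary: I xs ys)
  case (Suc n)
  from Suc.hyps(2) obtain xs' x where xs: "xs = xs' @ [x]" "length xs' = n"
    by (metis length_Suc_conv_rev)
  from Suc.hyps(2) Suc.prems(4) obtain ys' y where ys: "ys = ys' @ [y]" "length ys' = n"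
    by (metis length_Suc_conv_rev)
  let ?X = "adjoin_list I xs'" and ?Y = "adjoin_list I ys'"
  note I = Suc.prems(1)
  have x: "regseq I xs'" "x \<in> \<mm>" "nzd_mod ?X x" and y: "regseq I ys'" "y \<in> \<mm>" "nzd_mod ?Y y"
    using Suc.prems xs ys by (auto simp: regseq_append)
  have X: "ideal ?X R" and Y: "ideal ?Y R" using adjoin_list_ideal[OF I] regseq_set x y by auto
  obtain w where w: "w \<in> \<mm>" "nzd_mod ?X w" "nzd_mod ?Y w"
    using exists_common_nzd[OF X Y] mm_notin_ass X Y x y by blast
  then have wc: "w \<in> carrier R" using mm_carrier by blast
  have "\<mm> \<in> ass (adjoin ?X x)" using Suc.prems xs by (simp add: adjoin_list_append)
  then have "\<mm> \<in> ass (adjoin ?X w)" using mm_ass_exchange[OF X] x w by blast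
  then have "\<mm> \<in> ass (adjoin_list (adjoin I w) xs')"
    by (simp only: adjoin_list_adjoin[OF I regseq_set[OF x(1)] wc])
  moreover have "regseq (adjoin I w) xs'" "regseq (adjoin I w) ys'"
    using regseq_rotate[OF I x(1) wc w(2)] regseq_rotate[OF I y(1) wc w(3)] by auto
  ultimately have "\<mm> \<in> ass (adjoin_list (adjoin I w) ys')"
    using Suc.hyps(1)[of xs' "adjoin I w" ys'] xs(2) ys(2) adjoin_ideal[OF I wc] by simp
  then have "\<mm> \<in> ass (adjoin ?Y w)"
    by (simp only: adjoin_list_adjoin[OF I regseq_set[OF y(1)] wc])
  then have "\<mm> \<in> ass (adjoin ?Y y)" using mm_ass_exchange[OF Y] y w by blast
  then show ?case using ys by (simp add: adjoin_list_append)
qed simp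

text \<open>If \<open>xs\<close> could not be extended, then \<open>\<mm>\<close> would be associated to \<open>adjoin_list I xs\<close>, and by
  exchange also to the ideal of an initial segment of \<open>ys\<close>. The next element of \<open>ys\<close> prevents this.\<close>
lemma regseq_extend:
  assumes I: "ideal I R" and xs: "regseq I xs" and ys: "regseq I ys" and len: "length xs < length ys"
  shows "\<exists>x. regseq I (xs @ [x])"
proof -
  let ?n = "length xs"
  have X: "ideal (adjoin_list I xs) R" using adjoin_list_ideal[OF I] regseq_set xs by blast
  define ys' where "ys' = take ?n ys"
  have "ys = ys' @ ys ! ?n # drop (Suc ?n) ys"
    using len by (simp add: ys'_def id_take_nth_drop)
  then have y: "regseq I ys'" "ys ! ?n \<in> \<mm>" "nzd_mod (adjoin_list I ys') (ys ! ?n)"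
    using ys regseq_append[of I ys' "ys ! ?n # drop (Suc ?n) ys"] by auto
  have "\<mm> \<notin> ass (adjoin_list I ys')"
    using mm_notin_ass adjoin_list_ideal[OF I] regseq_set y by blast
  moreover have "?n = length ys'" using len by (simp add: ys'_def)
  ultimately have "\<mm> \<notin> ass (adjoin_list I xs)"
    using mm_ass_regseq_exchange[OF I xs y(1)] by blast
  then obtain x where "x \<in> \<mm>" "nzd_mod (adjoin_list I xs) x"
    using exists_common_nzd[OF X X] by blast
  then show ?thesis using xs by (auto simp: regseq_append)
qed

text \<open>Since \<open>xs\<close> extends to a regular sequence as long as \<open>ys\<close>, and each further element strictly
  enlarges the associated prime, a chain of primes can be built upwards from \<open>P\<close>.\<close>
lemma exists_prime_chain_above_ass:
  assumes I: "ideal I R" and ys: "regseq I ys"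
  shows "regseq I xs \<Longrightarrow> length xs \<le> length ys \<Longrightarrow> P \<in> ass (adjoin_list I xs) \<Longrightarrow>
    \<exists>c. prime_chain c \<and> hd c = P \<and> length c = Suc (length ys - length xs)"
proof (induction "length ys - length xs" arbitrary: xs P)
  case 0
  then have "prime_chain [P] \<and> hd [P] = P \<and> length [P] = Suc (length ys - length xs)"
    using assD(1)[of P] by (simp add: prime_chain_def Spec_def)
  then show ?case by blast
next
  case (Suc n)
  then have "length xs < length ys" by simp
  then obtain x where x: "regseq I (xs @ [x])" using regseq_extend[OF I Suc.prems(1) ys] by blast
  then have x': "x \<in> \<mm>" "nzd_mod (adjoin_list I xs) x" by (auto simp: regseq_append)
  have "ideal (adjoin_list I xs) R" using adjoin_list_ideal[OF I] regseq_set Suc.prems by blast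
  from ass_strictly_increases[OF this Suc.prems(3) x'] obtain Q
    where Q: "Q \<in> ass (adjoin_list I (xs @ [x]))" "P \<subset> Q" by (auto simp: adjoin_list_append)
  have "\<exists>c. prime_chain c \<and> hd c = Q \<and> length c = Suc (length ys - length (xs @ [x]))"
    using Suc.hyps(2) x Q by (intro Suc.hyps(1)) auto
  then obtain c where c: "prime_chain c" "hd c = Q" "length c = Suc (length ys - length (xs @ [x]))"
    by blast
  have "prime_chain (P # c)"
    using c(1,2) Q(2) assD(1)[OF Suc.prems(3)] by (cases c) (auto simp: prime_chain_def Spec_def)
  moreover have "length (P # c) = Suc (length ys - length xs)" using c(3) Suc.hyps(2) by simp
  ultimately show ?case by (metis list.sel(1))
qed

end

section \<open>Dimension and associated primes of Cohen-Macaulay local rings\<close>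

lemma (in cring) nzd_mod_of_quotient:
  assumes I: "ideal I R" and x: "x \<in> carrier R" "nonzerodivisor (R Quot I) (I +> x)"
  shows "nzd_mod I x"
  unfolding nzd_mod_def
proof (intro conjI ballI impI)
  fix b assume b: "b \<in> carrier R" "x \<otimes> b \<in> I"
  have car: "I +> b \<in> carrier (R Quot I)"
    using b by (auto simp: FactRing_def A_RCOSETS_def')
  have zero: "\<zero>\<^bsub>R Quot I\<^esub> = I" by (simp add: FactRing_def)
  have "(I +> x) \<otimes>\<^bsub>R Quot I\<^esub> (I +> b) = I +> (x \<otimes> b)"
    using ideal.rcoset_mult_add[OF I x(1) b(1)] by (simp add: FactRing_def)
  also have "\<dots> = \<zero>\<^bsub>R Quot I\<^esub>" using a_rcos_zero[OF I b(2)] zero by simp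
  finally have "I +> b = \<zero>\<^bsub>R Quot I\<^esub>" using x(2) car by (simp add: nonzerodivisor_def)
  then show "b \<in> I" using ideal.rcos_const_imp_mem[OF I b(1)] zero by simp
qed (rule x(1))

lemma (in cring) adjoin_Idl:
  assumes "S \<subseteq> carrier R" "x \<in> carrier R"
  shows "adjoin (Idl S) x = Idl (insert x S)"
proof
  have S: "ideal (Idl S) R" "ideal (Idl (insert x S)) R" using assms genideal_ideal by auto
  have self: "insert x S \<subseteq> Idl (insert x S)" "S \<subseteq> Idl S"
    by (rule genideal_self, use assms in blast)+
  then show "adjoin (Idl S) x \<subseteq> Idl (insert x S)"
    using S genideal_minimal by (intro adjoin_least) auto
  show "Idl (insert x S) \<subseteq> adjoin (Idl S) x"
    using adjoin_superset[OF S(1) assms(2)] adjoin_ideal[OF S(1) assms(2)] self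
    by (intro genideal_minimal) auto
qed

context noetherian_local_ring
begin

lemma adjoin_list_zero:
  assumes "set xs \<subseteq> \<mm>"
  shows "adjoin_list {\<zero>} xs = Idl (set xs)"
proof -
  have "adjoin_list (Idl S) xs = Idl (S \<union> set xs)" if "S \<subseteq> carrier R" for S
    using that assms
  proof (induction xs arbitrary: S)
    case (Cons x xs)
    then show ?case using adjoin_Idl[of S x] mm_carrier by simp
  qed simp
  from this[of "{}"] have "adjoin_list (Idl {}) xs = Idl (set xs)" by simp
  moreover have "Idl {} = {\<zero>}"
    using genideal_minimal[OF zeroideal] ideal_zero[OF genideal_ideal] by blast
  ultimately show ?thesis by simp
qed

lemma regular_sequence_imp_regseq:
  assumes "set xs \<subseteq> \<mm>" "regular_sequence R xs"
  shows "regseq {\<zero>} xs"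
proof -
  have "regseq {\<zero>} (take k xs)" if "k \<le> length xs" for k
    using that
  proof (induction k)
    case (Suc k)
    then have k: "k < length xs" by simp
    have set: "set (take k xs) \<subseteq> \<mm>" by (rule order_trans[OF set_take_subset assms(1)])
    have x: "xs ! k \<in> \<mm>" using assms(1) k by (simp add: subset_iff)
    have "nonzerodivisor (R Quot (Idl (set (take k xs)))) (Idl (set (take k xs)) +> (xs ! k))"
      using assms(2) k by (simp add: regular_sequence_def Let_def)
    moreover have "ideal (Idl (set (take k xs))) R"
      using set mm_carrier by (intro genideal_ideal) blast
    ultimately have "nzd_mod (adjoin_list {\<zero>} (take k xs)) (xs ! k)"
      using nzd_mod_of_quotient mm_carrier[OF x] adjoin_list_zero[OF set] by simp
    then show ?case using Suc x k by (simp add: take_Suc_conv_app_nth regseq_append)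
  qed simp
  from this[of "length xs"] show ?thesis by simp
qed

lemma zero_subset_mm: "{\<zero>} \<subseteq> \<mm>"
  using ideal_zero[OF mm_ideal] by simp

text \<open>A regular sequence that generates a maximal ideal among those generated by regular sequences
  cannot be extended. By the exchange property, no regular sequence is longer than it.\<close>
lemma exists_longest_regseq:
  "\<exists>xs. regseq {\<zero>} xs \<and> (\<forall>ys. regseq {\<zero>} ys \<longrightarrow> length ys \<le> length xs)"
proof -
  define C where "C = {adjoin_list {\<zero>} xs | xs. regseq {\<zero>} xs}"
  have "regseq {\<zero>} []" by simp
  then have "adjoin_list {\<zero>} [] \<in> C" unfolding C_def by blast
  then have "C \<noteq> {}" by blast
  moreover have "ideal K R" if "K \<in> C" for K
    using that adjoin_list_ideal[OF zeroideal] regseq_set by (auto simp: C_def)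
  ultimately have "\<exists>M \<in> C. \<forall>K \<in> C. M \<subseteq> K \<longrightarrow> K = M" by (rule exists_maximal_among_ideals)
  then obtain M where M: "M \<in> C" and max: "\<And>K. K \<in> C \<Longrightarrow> M \<subseteq> K \<Longrightarrow> K = M" by blast
  then obtain xs where xs: "regseq {\<zero>} xs" "M = adjoin_list {\<zero>} xs" by (auto simp: C_def)
  have ideal: "ideal M R" and sub: "M \<subseteq> \<mm>"
    unfolding xs(2) using adjoin_list_ideal[OF zeroideal] adjoin_list_subset_mm[OF zero_subset_mm]
      regseq_set[OF xs(1)] by auto
  have no_ext: "\<not> regseq {\<zero>} (xs @ [x])" for x
  proof
    assume reg: "regseq {\<zero>} (xs @ [x])"
    then have x: "x \<in> carrier R" "nzd_mod M x"
      using xs mm_carrier by (auto simp: regseq_append)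
    have "adjoin M x \<in> C"
      using reg xs(2) adjoin_list_append[of "{\<zero>}" xs "[x]"] unfolding C_def
      by (metis (mono_tags, lifting) adjoin_list.simps mem_Collect_eq)
    then have "adjoin M x = M" using max adjoin_superset(1)[OF ideal x(1)] by blast
    then have "x \<otimes> \<one> \<in> M" using adjoin_superset(2)[OF ideal x(1)] x(1) by simp
    then have "\<one> \<in> M" using x by (simp add: nzd_mod_def)
    then show False using sub prime_proper[OF mm_prime] by blast
  qed
  have "length ys \<le> length xs" if "regseq {\<zero>} ys" for ys
    using regseq_extend[OF zeroideal xs(1) that] no_ext by (meson not_le)
  then show ?thesis using xs(1) by blast
qed

end

lemma (in cring) prime_chain_length_le_dim:
  "prime_chain c \<Longrightarrow> ereal (real (length c) - 1) \<le> krull_dim R"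
  unfolding prime_chain_def krull_dim_def chain_dim_def by (intro Sup_upper) blast

lemma (in cring) prime_chain_length_le_height:
  "prime_chain c \<Longrightarrow> last c = P \<Longrightarrow> ereal (real (length c) - 1) \<le> height_prime R P"
  unfolding prime_chain_def height_prime_def by (intro Sup_upper) blast

lemma (in cring) height_prime_le:
  assumes "\<And>c. prime_chain c \<Longrightarrow> last c = P \<Longrightarrow> length c \<le> Suc n"
  shows "height_prime R P \<le> ereal (real n)"
  unfolding height_prime_def
proof (rule Sup_least)
  fix e assume "e \<in> {ereal (real (length c) - 1) | c.
    c \<noteq> [] \<and> last c = P \<and> set c \<subseteq> Spec R \<and> sorted_wrt (\<subset>) c}"
  then obtain c where c: "e = ereal (real (length c) - 1)" "prime_chain c" "last c = P"
    by (auto simp: prime_chain_def)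
  then show "e \<le> ereal (real n)" using assms[OF c(2,3)] by simp
qed

lemma (in cring) prime_chain_join:
  assumes "prime_chain c" "prime_chain d" "last c = hd d"
  shows "prime_chain (c @ tl d)"
proof -
  obtain c' P where c: "c = c' @ [P]" using assms(1) by (metis prime_chain_def rev_exhaust)
  obtain d' where d: "d = P # d'" using assms(2,3) c
    by (metis last_snoc list.exhaust_sel prime_chain_def)
  have cd: "sorted_wrt (\<subset>) (c' @ [P])" "sorted_wrt (\<subset>) (P # d')"
    "set (c' @ [P]) \<subseteq> Spec R" "set (P # d') \<subseteq> Spec R"
    using assms(1,2) unfolding prime_chain_def c d by auto
  have "x \<subset> y" if "x \<in> set c'" "y \<in> set d'" for x y
  proof (rule psubset_trans)
    show "x \<subset> P" "P \<subset> y" using cd(1,2) that by (simp_all add: sorted_wrt_append)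
  qed
  then show ?thesis using cd unfolding prime_chain_def c d by (simp add: sorted_wrt_append)
qed

context cohen_macaulay_local_ring
begin

text \<open>The depth is attained by a regular sequence, since their lengths are bounded. Associated primes
  of initial segments extend upwards to chains whose length makes up the dimension.\<close>
lemma exists_dim_chains:
  "\<exists>d. krull_dim R = ereal (real d) \<and>
    (\<forall>xs P. regseq {\<zero>} xs \<and> P \<in> ass (adjoin_list {\<zero>} xs) \<longrightarrow>
      length xs \<le> d \<and> (\<exists>c. prime_chain c \<and> hd c = P \<and> length c = Suc (d - length xs)))"
proof -
  define S where "S = {length xs | xs. set xs \<subseteq> \<mm> \<and> regular_sequence R xs}"
  obtain zs where zs: "regseq {\<zero>} zs" "\<And>ys. regseq {\<zero>} ys \<Longrightarrow> length ys \<le> length zs"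
    using exists_longest_regseq by blast
  have S: "S \<subseteq> {..length zs}"
    unfolding S_def using zs(2) regular_sequence_imp_regseq by blast
  then have fin: "finite S" by (rule finite_subset) simp
  have "Idl {} \<subseteq> \<mm>" using genideal_minimal[OF mm_ideal] by blast
  then have "regular_sequence R []"
    using prime_proper[OF mm_prime] by (auto simp: regular_sequence_def)
  then have "S \<noteq> {}" unfolding S_def by force
  then have max: "Max S \<in> S" using fin Max_in by blast
  then obtain ys where ys: "set ys \<subseteq> \<mm>" "regular_sequence R ys" "length ys = Max S"
    unfolding S_def by force
  then have reg: "regseq {\<zero>} ys" using regular_sequence_imp_regseq by blast
  have "depth R \<mm> = ereal (real (Max S))"
    unfolding depth_def
  proof (rule antisym)
    show "Sup {ereal (real (length xs)) | xs. set xs \<subseteq> \<mm> \<and> regular_sequence R xs}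
        \<le> ereal (real (Max S))"
    proof (rule Sup_least)
      fix e assume "e \<in> {ereal (real (length xs)) | xs. set xs \<subseteq> \<mm> \<and> regular_sequence R xs}"
      then obtain n where "e = ereal (real n)" "n \<in> S" unfolding S_def by blast
      then show "e \<le> ereal (real (Max S))" using fin by simp
    qed
    show "ereal (real (Max S)) \<le>
        Sup {ereal (real (length xs)) | xs. set xs \<subseteq> \<mm> \<and> regular_sequence R xs}"
      by (rule Sup_upper) (use ys in force)
  qed
  then have dim: "krull_dim R = ereal (real (length ys))" using depth_eq_dim ys by simp
  have "length xs \<le> length ys \<and>
      (\<exists>c. prime_chain c \<and> hd c = P \<and> length c = Suc (length ys - length xs))"
    if xs: "regseq {\<zero>} xs" and P: "P \<in> ass (adjoin_list {\<zero>} xs)" for xs P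
  proof
    have "\<one> \<notin> {\<zero>}" using zero_subset_mm prime_proper[OF mm_prime] by blast
    then obtain Q where "Q \<in> ass (adjoin_list {\<zero>} [])"
      using exists_ass_above_colon[OF zeroideal one_closed] by auto
    from exists_prime_chain_above_ass[OF zeroideal xs, of "[]", OF _ _ this]
    obtain c where c: "prime_chain c" "length c = Suc (length xs)" by auto
    show le: "length xs \<le> length ys" using prime_chain_length_le_dim[OF c(1)] c(2) dim by simp
    show "\<exists>c. prime_chain c \<and> hd c = P \<and> length c = Suc (length ys - length xs)"
      by (rule exists_prime_chain_above_ass[OF zeroideal reg xs le P])
  qed
  with dim show ?thesis by blast
qed

text \<open>A chain ending in \<open>P\<close> can be continued by a chain that starts at \<open>P\<close> and whose length is the
  dimension minus the length of \<open>xs\<close>.\<close>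
lemma height_ass_le:
  assumes "regseq {\<zero>} xs" "P \<in> ass (adjoin_list {\<zero>} xs)" "prime_chain c" "last c = P"
  shows "length c \<le> Suc (length xs)"
proof -
  obtain d e where d: "krull_dim R = ereal (real d)" "length xs \<le> d"
    and e: "prime_chain e" "hd e = P" "length e = Suc (d - length xs)"
    using exists_dim_chains assms(1,2) by blast
  have "prime_chain (c @ tl e)" using prime_chain_join assms e by simp
  from prime_chain_length_le_dim[OF this] show ?thesis using d e by simp
qed

text \<open>An associated prime of zero is the start of a chain of maximal length, which leaves no room for
  a smaller prime.\<close>
lemma minimal_primes_eq_ass: "minimal_primes R = ass {\<zero>}"
proof
  show "minimal_primes R \<subseteq> ass {\<zero>}"
  proof
    fix P assume P: "P \<in> minimal_primes R"
    then have "primeideal P R" by (simp add: minimal_primes_def Spec_def)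
    moreover have "{\<zero>} \<subseteq> P"
      using ideal_zero primeideal.axioms(1)[OF calculation] by blast
    ultimately show "P \<in> ass {\<zero>}"
      using P by (intro minimal_over_imp_ass[OF zeroideal]) (auto simp: minimal_primes_def Spec_def)
  qed
  show "ass {\<zero>} \<subseteq> minimal_primes R"
  proof
    fix P assume P: "P \<in> ass {\<zero>}"
    have "Q = P" if Q: "Q \<in> Spec R" "Q \<subseteq> P" for Q
    proof (rule ccontr)
      assume "Q \<noteq> P"
      then have "prime_chain [Q, P]"
        using Q assD(1)[OF P] by (auto simp: prime_chain_def Spec_def)
      then show False using height_ass_le[of "[]" P "[Q, P]"] P by simp
    qed
    then show "P \<in> minimal_primes R" using assD(1)[OF P] by (simp add: minimal_primes_def Spec_def)
  qed
qed

lemma minimal_primesD: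
  assumes "P \<in> minimal_primes R"
  shows "primeideal P R" "ideal P R" "Q \<in> Spec R \<Longrightarrow> Q \<subseteq> P \<Longrightarrow> Q = P"
  using assms by (auto simp: minimal_primes_def Spec_def primeideal.axioms(1))

lemma minimal_primes_antichain:
  "P \<in> minimal_primes R \<Longrightarrow> Q \<in> minimal_primes R \<Longrightarrow> P \<subseteq> Q \<Longrightarrow> P = Q"
  by (auto simp: minimal_primes_def)

lemma exists_minimal_prime_below:
  assumes "primeideal Q R"
  shows "\<exists>P \<in> minimal_primes R. P \<subseteq> Q"
  using exists_ass_below_prime[OF zeroideal assms] ideal_zero[OF primeideal.axioms(1)[OF assms]]
  by (simp add: minimal_primes_eq_ass)

lemma height_prime_ass_le:
  assumes "regseq {\<zero>} xs" "P \<in> ass (adjoin_list {\<zero>} xs)"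
  shows "height_prime R P \<le> ereal (real (length xs))"
  by (rule height_prime_le) (rule height_ass_le[OF assms])

section \<open>Hartshorne's connectedness argument\<close>

text \<open>The elements that vanish in the local ring at each prime in \<open>A\<close>. The localizations are used
  instead of the intersection of the primes in \<open>A\<close>, so that complementary sets of minimal primes
  have ideals with intersection zero, and not merely with nilpotent intersection.\<close>
definition germ_zero :: "'a set set \<Rightarrow> 'a set" where
  "germ_zero A = carrier R \<inter> (\<Inter>a \<in> A. sat {\<zero>} a)"

lemma germ_zero_ideal:
  assumes "A \<subseteq> minimal_primes R"
  shows "ideal (germ_zero A) R"
proof (rule idealI_elementwise)
  have sat: "ideal (sat {\<zero>} a) R" if "a \<in> A" for a
    using that assms sat_ideal[OF zeroideal] minimal_primesD(1) by blast
  show "\<zero> \<in> germ_zero A" using ideal_zero[OF sat] by (auto simp: germ_zero_def)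
  show "x \<oplus> y \<in> germ_zero A" if "x \<in> germ_zero A" "y \<in> germ_zero A" for x y
    using that ideal_add[OF sat] by (auto simp: germ_zero_def)
  show "r \<otimes> x \<in> germ_zero A" if "x \<in> germ_zero A" "r \<in> carrier R" for x r
    using that ideal.I_l_closed[OF sat] by (auto simp: germ_zero_def)
qed (auto simp: germ_zero_def)

lemma germ_zero_subset:
  assumes "A \<subseteq> minimal_primes R" "a \<in> A"
  shows "germ_zero A \<subseteq> a"
proof -
  have a: "primeideal a R" "ideal a R" using assms minimal_primesD by auto
  have "sat {\<zero>} a \<subseteq> a" using sat_subset_prime[OF a(1)] ideal_zero[OF a(2)] by simp
  then show ?thesis using assms by (auto simp: germ_zero_def)
qed

text \<open>The kernel of the localization at a minimal prime \<open>a\<close> is \<open>a\<close>-primary: its only associated prime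
  is \<open>a\<close>, so that every prime above the kernel contains \<open>a\<close>.\<close>
lemma sat_zero_subset_prime:
  assumes a: "a \<in> minimal_primes R" and Q: "primeideal Q R" and sub: "sat {\<zero>} a \<subseteq> Q"
  shows "a \<subseteq> Q"
proof -
  note a' = minimal_primesD[OF a]
  obtain P where P: "P \<in> ass (sat {\<zero>} a)" "P \<subseteq> Q"
    using exists_ass_below_prime[OF sat_ideal[OF zeroideal a'(1)] Q sub] by blast
  then have "P \<subseteq> a" using ass_sat(2)[OF zeroideal a'(1)] by blast
  then have "P = a" using a'(3) assD(1)[OF P(1)] by (simp add: Spec_def)
  with P show ?thesis by blast
qed

lemma germ_zero_subset_prime:
  assumes A: "A \<subseteq> minimal_primes R" and Q: "primeideal Q R" and sub: "germ_zero A \<subseteq> Q"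
  shows "\<exists>a \<in> A. a \<subseteq> Q"
proof (rule ccontr)
  assume none: "\<not> (\<exists>a \<in> A. a \<subseteq> Q)"
  have "finite A" using A finite_ass[OF zeroideal] finite_subset by (auto simp: minimal_primes_eq_ass)
  then have "\<exists>y \<in> carrier R. y \<notin> Q \<and> (\<forall>K \<in> (\<lambda>a. sat {\<zero>} a) ` A. y \<in> K)"
  proof (intro exists_mem_Inter_notin_prime[OF _ _ Q oneideal])
    show "ideal K R \<and> \<not> K \<subseteq> Q" if "K \<in> (\<lambda>a. sat {\<zero>} a) ` A" for K
      using that none A sat_zero_subset_prime[OF _ Q] sat_ideal[OF zeroideal] minimal_primesD(1)
      by blast
    show "\<not> carrier R \<subseteq> Q" using prime_proper[OF Q] by blast
  qed simp
  then show False using sub by (auto simp: germ_zero_def)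
qed

text \<open>The annihilator of a nonzero element lies in an associated prime, and all of these belong to
  \<open>A\<close> or \<open>B\<close>.\<close>
lemma germ_zero_Int:
  assumes "r \<in> germ_zero A" "r \<in> germ_zero B" "minimal_primes R \<subseteq> A \<union> B"
  shows "r = \<zero>"
proof (rule ccontr)
  assume "r \<noteq> \<zero>"
  have r: "r \<in> carrier R" using assms by (simp add: germ_zero_def)
  then obtain P where P: "P \<in> minimal_primes R" "colon {\<zero>} r \<subseteq> P"
    using exists_ass_above_colon[OF zeroideal r] \<open>r \<noteq> \<zero>\<close> by (auto simp: minimal_primes_eq_ass)
  then have "r \<in> sat {\<zero>} P" using assms by (auto simp: germ_zero_def)
  then show False using P by (auto simp: sat_def colon_def)
qed

lemma nzd_cancel:
  assumes "nzd_mod {\<zero>} x" "u \<in> carrier R" "v \<in> carrier R" "x \<otimes> u = x \<otimes> v"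
  shows "u = v"
proof -
  have x: "x \<in> carrier R" using assms by (simp add: nzd_mod_def)
  have "x \<otimes> (u \<ominus> v) = x \<otimes> u \<ominus> x \<otimes> v" using x assms(2,3) by algebra
  also have "\<dots> = \<zero>" using assms x by simp
  finally have "u \<ominus> v = \<zero>" using assms by (simp add: nzd_mod_def)
  then show ?thesis using assms by simp
qed

text \<open>Here \<open>f \<otimes> s\<close> kills \<open>a\<close> and \<open>i\<close> kills \<open>b\<close>, so that \<open>(f \<otimes> s) \<otimes> i\<close> kills \<open>x\<close>.\<close>
lemma annihilator_of_component:
  assumes nzd: "nzd_mod {\<zero>} x" and x: "x = a \<oplus> b"
    and carr: "a \<in> carrier R" "b \<in> carrier R" "e \<in> carrier R" "f \<in> carrier R" "s \<in> carrier R"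
    and sa: "s \<otimes> a = e \<otimes> x" and fe: "f \<otimes> e = \<zero>" and i: "i \<in> carrier R" "i \<otimes> b = \<zero>"
  shows "(f \<otimes> s) \<otimes> i = \<zero>"
proof (rule nzd_cancel[OF nzd])
  have xc: "x \<in> carrier R" using x carr by simp
  have "x \<otimes> ((f \<otimes> s) \<otimes> i) = f \<otimes> i \<otimes> (s \<otimes> a) \<oplus> f \<otimes> s \<otimes> (i \<otimes> b)"
    unfolding x using carr i(1) by algebra
  also have "\<dots> = f \<otimes> i \<otimes> (e \<otimes> x)" using sa i carr xc by simp
  also have "\<dots> = (f \<otimes> e) \<otimes> (i \<otimes> x)" using carr i(1) xc by algebra
  also have "\<dots> = x \<otimes> \<zero>" using fe i(1) xc by simp
  finally show "x \<otimes> ((f \<otimes> s) \<otimes> i) = x \<otimes> \<zero>" .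
qed (use carr i in auto)

text \<open>Suppose that \<open>A\<close> and \<open>B\<close> do not meet in codimension one inside \<open>P\<close>. The ideals \<open>I\<close> and \<open>J\<close> of
  elements that vanish near the components in \<open>A\<close> and \<open>B\<close> satisfy \<open>I \<inter> J = 0\<close>, and \<open>I + J\<close> contains
  elements \<open>x = a + b\<close> and \<open>y = c + d\<close> that form a regular sequence after localization at \<open>P\<close>.
  From \<open>y a = a c = x c\<close> it follows that, locally, \<open>a = e x\<close> with an idempotent \<open>e\<close>; the denominator
  \<open>s\<close> is cleared below, where \<open>e \<oplus> f = s\<close> and \<open>e \<otimes> f = \<zero>\<close>. One of \<open>e\<close> and \<open>f\<close> is invertible
  at \<open>P\<close>, and it kills \<open>J\<close> or \<open>I\<close>, respectively, which is impossible at the components that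
  pass through \<open>P\<close>.\<close>
lemma components_meet_in_codim_1:
  assumes P: "primeideal P R" and AB: "A \<union> B = minimal_primes R" "A \<inter> B = {}"
    and p: "p \<in> A" "p \<subseteq> P" and q: "q \<in> B" "q \<subseteq> P"
  shows "\<exists>a \<in> A. \<exists>b \<in> B. \<exists>Q. primeideal Q R \<and> a \<subseteq> Q \<and> b \<subseteq> Q \<and> Q \<subseteq> P \<and> height_prime R Q \<le> 1"
proof (rule ccontr)
  assume none: "\<not> ?thesis"
  have min: "A \<subseteq> minimal_primes R" "B \<subseteq> minimal_primes R" using AB by auto
  define I where "I = germ_zero A"
  define J where "J = germ_zero B"
  define K where "K = I <+>\<^bsub>R\<^esub> J"
  have I: "ideal I R" and J: "ideal J R" using min germ_zero_ideal by (simp_all add: I_def J_def)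
  note Ic = ideal_carrier[OF I] and Jc = ideal_carrier[OF J]
  have prod: "i \<otimes> j = \<zero>" if "i \<in> I" "j \<in> J" for i j
  proof (rule germ_zero_Int[of _ A B])
    show "i \<otimes> j \<in> germ_zero A" using ideal.I_r_closed[OF I] Jc that unfolding I_def by blast
    show "i \<otimes> j \<in> germ_zero B" using ideal.I_l_closed[OF J] Ic that unfolding J_def by blast
  qed (use AB in blast)
  have K: "ideal K R" and IK: "I \<subseteq> K" and JK: "J \<subseteq> K"
    using add_ideals[OF I J] summands_subset_sum[OF I J] by (simp_all add: K_def)
  have K_above: "\<exists>a \<in> A. \<exists>b \<in> B. a \<subseteq> Q \<and> b \<subseteq> Q" if Q: "primeideal Q R" "K \<subseteq> Q" for Q
  proof -
    have "germ_zero A \<subseteq> Q" "germ_zero B \<subseteq> Q"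
      using IK JK Q(2) unfolding I_def J_def by blast+
    then show ?thesis using germ_zero_subset_prime[OF min(1) Q(1)] germ_zero_subset_prime[OF min(2) Q(1)]
      by blast
  qed
  have K_min: "\<not> K \<subseteq> Q" if Q: "Q \<in> minimal_primes R" for Q
  proof
    assume "K \<subseteq> Q"
    then obtain a b where ab: "a \<in> A" "b \<in> B" "a \<subseteq> Q" "b \<subseteq> Q"
      using K_above minimal_primesD(1)[OF Q] by blast
    then have "a = Q" "b = Q" using minimal_primes_antichain[OF _ Q, of a]
      minimal_primes_antichain[OF _ Q, of b] min by blast+
    then show False using ab AB by blast
  qed
  have ass_prime: "primeideal Q R" if "Q \<in> ass L" for Q L by (rule assD(1)[OF that])
  have "\<exists>x \<in> K. \<forall>Q \<in> ass {\<zero>}. x \<notin> Q"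
    using K_min ass_prime by (intro prime_avoidance finite_ass zeroideal K)
      (auto simp: minimal_primes_eq_ass)
  then obtain x where x: "x \<in> K" "\<forall>Q \<in> ass {\<zero>}. x \<notin> Q" by blast
  have xc: "x \<in> carrier R" using x(1) ideal_carrier[OF K] by blast
  then have nzx: "nzd_mod {\<zero>} x" using nzd_mod_iff_notin_ass[OF zeroideal xc] x(2) by blast
  obtain a b where ab: "a \<in> I" "b \<in> J" "x = a \<oplus> b" using x(1) by (auto simp: K_def set_add_def')
  have ac: "a \<in> carrier R" "b \<in> carrier R" using ab Ic Jc by auto
  have "a \<in> \<mm>" "b \<in> \<mm>"
    using ab germ_zero_subset[OF min(1) p(1)] germ_zero_subset[OF min(2) q(1)] p(2) q(2)
      prime_subset_mm[OF P] unfolding I_def J_def by blast+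
  then have xm: "x \<in> \<mm>" using ideal_add[OF mm_ideal] ab by simp
  let ?X = "adjoin {\<zero>} x"
  have X: "ideal ?X R" using adjoin_ideal[OF zeroideal xc] .
  have K_codim_1: "\<not> K \<subseteq> Q" if Q: "Q \<in> ass ?X" "Q \<subseteq> P" for Q
  proof -
    have "height_prime R Q \<le> ereal (real (length [x]))"
      using xm nzx Q(1) by (intro height_prime_ass_le) simp_all
    then have "height_prime R Q \<le> 1" by (simp add: one_ereal_def)
    then show ?thesis using K_above[OF ass_prime[OF Q(1)]] ass_prime[OF Q(1)] Q(2) none by blast
  qed
  \<comment> \<open>Outside the minimal primes, \<open>y\<close> is a nonzerodivisor of \<open>R\<close>. Modulo \<open>x\<close> only the associated primes
    inside \<open>P\<close> can be avoided, which suffices after localization at \<open>P\<close>.\<close>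
  have "\<exists>y \<in> K. \<forall>Q \<in> ass {\<zero>} \<union> {Q \<in> ass ?X. Q \<subseteq> P}. y \<notin> Q"
  proof (rule prime_avoidance[OF _ _ K])
    show "finite (ass {\<zero>} \<union> {Q \<in> ass ?X. Q \<subseteq> P})" using finite_ass[OF zeroideal] finite_ass[OF X] by simp
    show "primeideal Q R \<and> \<not> K \<subseteq> Q" if "Q \<in> ass {\<zero>} \<union> {Q \<in> ass ?X. Q \<subseteq> P}" for Q
      using that K_min K_codim_1 ass_prime by (auto simp: minimal_primes_eq_ass)
  qed
  then obtain y where y: "y \<in> K" "\<forall>Q \<in> ass {\<zero>}. y \<notin> Q" "\<forall>Q \<in> ass ?X. Q \<subseteq> P \<longrightarrow> y \<notin> Q" by blast
  have yc: "y \<in> carrier R" using y(1) ideal_carrier[OF K] by blast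
  have nzy: "nzd_mod {\<zero>} y" using nzd_mod_iff_notin_ass[OF zeroideal yc] y(2) by blast
  have "\<forall>Q \<in> ass (sat ?X P). y \<notin> Q" using ass_sat[OF X P] y(3) by blast
  then have nzy': "nzd_mod (sat ?X P) y" using nzd_mod_iff_notin_ass[OF sat_ideal[OF X P] yc] by blast
  obtain c d where cd: "c \<in> I" "d \<in> J" "y = c \<oplus> d" using y(1) by (auto simp: K_def set_add_def')
  have cc: "c \<in> carrier R" "d \<in> carrier R" using cd Ic Jc by auto
  have ya: "y \<otimes> a = a \<otimes> c"
  proof -
    have "y \<otimes> a = a \<otimes> c \<oplus> a \<otimes> d" unfolding cd(3) using ac(1) cc by algebra
    then show ?thesis using prod[OF ab(1) cd(2)] ac cc by simp
  qed
  have xa: "x \<otimes> c = a \<otimes> c"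
  proof -
    have "x \<otimes> c = a \<otimes> c \<oplus> c \<otimes> b" unfolding ab(3) using ac cc(1) by algebra
    then show ?thesis using prod[OF cd(1) ab(2)] ac cc by simp
  qed
  have "y \<otimes> a \<in> ?X"
  proof -
    have "y \<otimes> a = c \<otimes> x" using ya xa cc xc by (simp add: m_comm)
    then show ?thesis using ideal.I_l_closed[OF X adjoin_superset(2)[OF zeroideal xc] cc(1)] by simp
  qed
  moreover have "?X \<subseteq> sat ?X P"
    using prime_proper[OF P] ideal_carrier[OF X] unfolding sat_def by force
  ultimately have "a \<in> sat ?X P" using nzy' ac by (auto simp: nzd_mod_def)
  then obtain s e where s: "s \<in> carrier R" "s \<notin> P" and e: "e \<in> carrier R" "s \<otimes> a = \<zero> \<oplus> e \<otimes> x"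
    by (auto simp: sat_def adjoin_def)
  have sa: "s \<otimes> a = e \<otimes> x" using e xc by simp
  define f where "f = s \<ominus> e"
  have fc: "f \<in> carrier R" and sef: "s = e \<oplus> f"
    unfolding f_def using s(1) e(1) by (simp, algebra)
  have sc: "s \<otimes> c = y \<otimes> e"
  proof (rule nzd_cancel[OF nzx])
    have "x \<otimes> (s \<otimes> c) = s \<otimes> (x \<otimes> c)" using xc s(1) cc(1) by algebra
    also have "\<dots> = s \<otimes> (y \<otimes> a)" using xa ya by simp
    also have "\<dots> = y \<otimes> (s \<otimes> a)" using yc s(1) ac(1) by algebra
    also have "\<dots> = x \<otimes> (y \<otimes> e)" unfolding sa using yc e(1) xc by algebra
    finally show "x \<otimes> (s \<otimes> c) = x \<otimes> (y \<otimes> e)" .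
  qed (use s cc yc e in auto)
  have sb: "s \<otimes> b = f \<otimes> x"
  proof -
    have "s \<otimes> b = s \<otimes> x \<ominus> s \<otimes> a" unfolding ab(3) using s(1) ac by algebra
    also have "\<dots> = f \<otimes> x" unfolding sa f_def using s(1) e(1) xc by algebra
    finally show ?thesis .
  qed
  have sd: "s \<otimes> d = f \<otimes> y"
  proof -
    have "s \<otimes> d = s \<otimes> y \<ominus> s \<otimes> c" unfolding cd(3) using s(1) cc by algebra
    also have "\<dots> = f \<otimes> y" unfolding sc f_def using s(1) e(1) yc by algebra
    finally show ?thesis .
  qed
  have "y \<otimes> (f \<otimes> e) = y \<otimes> \<zero>"
  proof (rule nzd_cancel[OF nzx])
    have "x \<otimes> (y \<otimes> (f \<otimes> e)) = (e \<otimes> x) \<otimes> (f \<otimes> y)" using xc yc fc e(1) by algebra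
    also have "\<dots> = (s \<otimes> a) \<otimes> (s \<otimes> d)" using sa sd by simp
    also have "\<dots> = s \<otimes> s \<otimes> (a \<otimes> d)" using s(1) ac(1) cc(2) by algebra
    also have "\<dots> = x \<otimes> (y \<otimes> \<zero>)" using prod[OF ab(1) cd(2)] s(1) xc yc by simp
    finally show "x \<otimes> (y \<otimes> (f \<otimes> e)) = x \<otimes> (y \<otimes> \<zero>)" .
  qed (use yc fc e in auto)
  then have fe: "f \<otimes> e = \<zero>" using nzd_cancel[OF nzy] fc e by simp
  then have ef: "e \<otimes> f = \<zero>" using fc e by (simp add: m_comm)
  have "e \<notin> P \<or> f \<notin> P" using s(2) sef ideal_add[OF primeideal.axioms(1)[OF P]] by blast
  then show False
  proof
    assume f: "f \<notin> P"
    have fs: "f \<otimes> s \<notin> P" using prime_mult_notin[OF P fc s(1) f s(2)] .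
    have "I \<subseteq> q"
    proof
      fix i assume i: "i \<in> I"
      have "(f \<otimes> s) \<otimes> i = \<zero>"
        by (rule annihilator_of_component[OF nzx ab(3) ac e(1) fc s(1) sa fe Ic[OF i] prod[OF i ab(2)]])
      then have "(f \<otimes> s) \<otimes> i \<in> q" using ideal_zero minimal_primesD(2) min(2) q(1) by auto
      then show "i \<in> q"
        using primeideal.I_prime[OF minimal_primesD(1), of q "f \<otimes> s" i] min(2) q fs fc s(1) Ic[OF i]
        by blast
    qed
    then obtain a' where "a' \<in> A" "a' \<subseteq> q"
      using germ_zero_subset_prime[OF min(1) minimal_primesD(1)] min(2) q(1) unfolding I_def by blast
    then have "a' = q"
      using minimal_primes_antichain[of a' q] min q(1) \<open>a' \<in> A\<close> by blast
    then show False using \<open>a' \<in> A\<close> q(1) AB by blast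
  next
    assume e': "e \<notin> P"
    have es: "e \<otimes> s \<notin> P" using prime_mult_notin[OF P e(1) s(1) e' s(2)] .
    have "J \<subseteq> p"
    proof
      fix j assume j: "j \<in> J"
      have x': "x = b \<oplus> a" using ab(3) ac by (simp add: a_comm)
      have "j \<otimes> a = \<zero>" using prod[OF ab(1) j] Jc[OF j] ac by (simp add: m_comm)
      then have "(e \<otimes> s) \<otimes> j = \<zero>"
        by (rule annihilator_of_component[OF nzx x' ac(2,1) fc e(1) s(1) sb ef Jc[OF j]])
      then have "(e \<otimes> s) \<otimes> j \<in> p" using ideal_zero minimal_primesD(2) min(1) p(1) by auto
      then show "j \<in> p"
        using primeideal.I_prime[OF minimal_primesD(1), of p "e \<otimes> s" j] min(1) p es e(1) s(1) Jc[OF j]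
        by blast
    qed
    then obtain b' where "b' \<in> B" "b' \<subseteq> p"
      using germ_zero_subset_prime[OF min(2) minimal_primesD(1)] min(1) p(1) unfolding J_def by blast
    then have "b' = p"
      using minimal_primes_antichain[of b' p] min p(1) \<open>b' \<in> B\<close> by blast
    then show False using \<open>b' \<in> B\<close> p(1) AB by blast
  qed
qed

section \<open>Chains of minimal primes\<close>

lemma exists_codim_1_path:
  assumes p: "p \<in> minimal_primes R" and p': "p' \<in> minimal_primes R"
    and P: "primeideal P R" "p <+>\<^bsub>R\<^esub> p' \<subseteq> P"
  shows "\<exists>ps. ps \<noteq> [] \<and> hd ps = p \<and> last ps = p' \<and>
    (\<forall>j < length ps. ps ! j \<in> minimal_primes R \<and> ps ! j \<subseteq> P) \<and>
    (\<forall>i. i + 1 < length ps \<longrightarrow> height R (ps ! i <+>\<^bsub>R\<^esub> ps ! (i + 1)) \<le> 1)"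
proof -
  \<comment> \<open>If \<open>p'\<close> were not reachable from \<open>p\<close>, the reachable minimal primes would be linked inside \<open>P\<close> to
    one of the others in codimension one, making that one reachable too.\<close>
  define E where "E = {(u, v). v \<in> minimal_primes R \<and> v \<subseteq> P \<and> height R (u <+>\<^bsub>R\<^esub> v) \<le> 1}"
  have pP: "p \<subseteq> P" "p' \<subseteq> P"
    using summands_subset_sum[OF minimal_primesD(2)[OF p] minimal_primesD(2)[OF p']] P(2) by auto
  define A where "A = {u \<in> minimal_primes R. (p, u) \<in> E\<^sup>*}"
  have "p' \<in> A"
  proof (rule ccontr)
    assume "p' \<notin> A"
    then have q: "p' \<in> minimal_primes R - A" using p' by blast
    have "p \<in> A" using p by (simp add: A_def)
    have AB: "A \<union> (minimal_primes R - A) = minimal_primes R" "A \<inter> (minimal_primes R - A) = {}"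
      by (auto simp: A_def)
    obtain a b Q where ab: "a \<in> A" "b \<in> minimal_primes R - A"
      and Q: "primeideal Q R" "a \<subseteq> Q" "b \<subseteq> Q" "Q \<subseteq> P" "height_prime R Q \<le> 1"
      using components_meet_in_codim_1[OF P(1) AB \<open>p \<in> A\<close> pP(1) q pP(2)] by blast
    have "a <+>\<^bsub>R\<^esub> b \<subseteq> Q"
      using Q(2,3) ideal_add[OF primeideal.axioms(1)[OF Q(1)]] unfolding set_add_def' by blast
    then have "height R (a <+>\<^bsub>R\<^esub> b) \<le> height_prime R Q"
      unfolding height_def using Q(1) by (intro INF_lower) (simp add: Spec_def)
    then have "height R (a <+>\<^bsub>R\<^esub> b) \<le> 1" using Q(5) by (rule order_trans)
    then have "(a, b) \<in> E" using ab Q by (auto simp: E_def)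
    then show False using ab by (auto simp: A_def intro: rtrancl_into_rtrancl)
  qed
  then have "(p, p') \<in> E\<^sup>*" by (simp add: A_def)
  then show ?thesis
  proof (induction rule: rtrancl_induct)
    case base
    show ?case using p pP by (intro exI[of _ "[p]"]) simp
  next
    case (step u v)
    then obtain ps where ps: "ps \<noteq> []" "hd ps = p" "last ps = u"
      "\<forall>j < length ps. ps ! j \<in> minimal_primes R \<and> ps ! j \<subseteq> P"
      "\<forall>i. i + 1 < length ps \<longrightarrow> height R (ps ! i <+>\<^bsub>R\<^esub> ps ! (i + 1)) \<le> 1" by blast
    have v: "v \<in> minimal_primes R" "v \<subseteq> P" "height R (u <+>\<^bsub>R\<^esub> v) \<le> 1"
      using step by (auto simp: E_def)
    have "height R ((ps @ [v]) ! i <+>\<^bsub>R\<^esub> (ps @ [v]) ! (i + 1)) \<le> 1" if i: "i + 1 < length (ps @ [v])" for i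
    proof (cases "i + 1 < length ps")
      case True
      then show ?thesis using ps(5) by (simp add: nth_append)
    next
      case False
      then have "i = length ps - 1" "i < length ps" "i + 1 = length ps" using i ps(1) by auto
      then have "(ps @ [v]) ! i = u" "(ps @ [v]) ! (i + 1) = v"
        using ps(1,3) by (simp_all add: nth_append last_conv_nth)
      then show ?thesis using v(3) by simp
    qed
    moreover have "\<forall>j < length (ps @ [v]). (ps @ [v]) ! j \<in> minimal_primes R \<and> (ps @ [v]) ! j \<subseteq> P"
      using ps(4) v by (auto simp: nth_append less_Suc_eq)
    ultimately show ?case using ps(1,2) by (intro exI[of _ "ps @ [v]"]) simp
  qed
qed

section \<open>Connectedness in codimension one\<close>

text \<open>Sending a prime to its closure reverses inclusions and turns a chain of primes in \<open>Z\<close> into a chain of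
  irreducible closed subsets. A closed set that contains the first prime contains the whole chain.\<close>
lemma top_dim_closed_ge:
  assumes Z: "closedin (zariski_topology R) Z" and c: "prime_chain c" "hd c \<in> Z"
  shows "ereal (real (length c) - 1) \<le> top_dim (subtopology (zariski_topology R) Z)"
proof -
  define V where "V P = {Q \<in> Spec R. P \<subseteq> Q}" for P
  obtain E where E: "Z = {P \<in> Spec R. E \<subseteq> P}" using Z unfolding closedin_zariski by blast
  have c': "c \<noteq> []" "set c \<subseteq> Spec R" "sorted_wrt (\<subset>) c" using c(1) by (auto simp: prime_chain_def)
  have above: "hd c \<subseteq> P" if "P \<in> set c" for P
    using that c' by (cases c) auto
  have irred: "irreducible_closedin (subtopology (zariski_topology R) Z) (V P)" if P: "P \<in> set c" for P
  proof -
    have PS: "P \<in> Spec R" using c' P by blast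
    have VZ: "V P \<subseteq> Z" using above[OF P] c(2) unfolding E V_def by blast
    have "P \<subseteq> carrier R" using PS ideal_carrier primeideal.axioms(1) by (auto simp: Spec_def)
    then have "closedin (zariski_topology R) (V P)" unfolding closedin_zariski V_def by blast
    then have closed: "closedin (subtopology (zariski_topology R) Z) (V P)"
      using closedin_closed_subtopology[OF Z] VZ by blast
    have up: "V P \<subseteq> S" if S: "closedin (subtopology (zariski_topology R) Z) S" "P \<in> S" for S
    proof -
      have "closedin (zariski_topology R) S" using S(1) closedin_closed_subtopology[OF Z] by blast
      then obtain F where "S = {P \<in> Spec R. F \<subseteq> P}" unfolding closedin_zariski by blast
      then show ?thesis using S(2) unfolding V_def by blast
    qed
    have PV: "P \<in> V P" using PS by (simp add: V_def)
    show ?thesis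
      unfolding irreducible_closedin_def
    proof (intro conjI allI impI)
      fix S T
      assume ST: "closedin (subtopology (zariski_topology R) Z) S \<and>
        closedin (subtopology (zariski_topology R) Z) T \<and> V P = S \<union> T"
      then have "P \<in> S \<or> P \<in> T" using PV by blast
      then show "V P = S \<or> V P = T" using up ST by blast
    qed (use closed PV in auto)
  qed
  have "V P' \<subset> V P" if "P \<in> set c" "P \<subset> P'" for P P'
    using that c'(2) unfolding V_def by blast
  then have "sorted_wrt (\<lambda>P P'. V P' \<subset> V P) c"
    using c'(3) by (rule_tac sorted_wrt_mono_rel[of c "(\<subset>)"]) auto
  then have "sorted_wrt (\<subset>) (map V (rev c))"
    by (simp add: sorted_wrt_map sorted_wrt_rev)
  moreover have "set (map V (rev c)) \<subseteq> {S. irreducible_closedin (subtopology (zariski_topology R) Z) S}"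
    using irred by auto
  ultimately have "ereal (real (length (map V (rev c))) - 1) \<le>
      top_dim (subtopology (zariski_topology R) Z)"
    unfolding top_dim_def chain_dim_def by (intro Sup_upper) blast
  then show ?thesis by simp
qed

text \<open>A non-minimal prime contains a nonzerodivisor \<open>x\<close>. If its height is one, it is minimal over \<open>x\<close>
  and hence associated to it.\<close>
lemma exists_codim_1_chain:
  assumes Q: "primeideal Q R" "height_prime R Q \<le> 1"
  shows "\<exists>c. prime_chain c \<and> hd c = Q \<and> krull_dim R - 1 \<le> ereal (real (length c) - 1)"
proof (cases "Q \<in> minimal_primes R")
  case True
  then have "Q \<in> ass (adjoin_list {\<zero>} [])" by (simp add: minimal_primes_eq_ass)
  moreover obtain d where d: "krull_dim R = ereal (real d)" and
    chain: "\<And>xs P. regseq {\<zero>} xs \<and> P \<in> ass (adjoin_list {\<zero>} xs) \<Longrightarrow>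
      length xs \<le> d \<and> (\<exists>c. prime_chain c \<and> hd c = P \<and> length c = Suc (d - length xs))"
    using exists_dim_chains by blast
  ultimately obtain c where "prime_chain c" "hd c = Q" "length c = Suc d"
    using chain[of "[]" Q] by auto
  with d show ?thesis by (intro exI[of _ c]) (simp add: one_ereal_def)
next
  case False
  have "\<exists>x \<in> Q. \<forall>P \<in> ass {\<zero>}. x \<notin> P"
  proof (rule prime_avoidance[OF finite_ass[OF zeroideal] _ primeideal.axioms(1)[OF Q(1)]])
    show "primeideal P R \<and> \<not> Q \<subseteq> P" if "P \<in> ass {\<zero>}" for P
    proof -
      have P: "P \<in> minimal_primes R" using that by (simp add: minimal_primes_eq_ass)
      have "Q \<in> Spec R" using Q by (simp add: Spec_def)
      then show ?thesis using minimal_primesD(1)[OF P] minimal_primesD(3)[OF P, of Q] P False by blast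
    qed
  qed
  then obtain x where x: "x \<in> Q" "\<forall>P \<in> ass {\<zero>}. x \<notin> P" by blast
  have xm: "x \<in> \<mm>" using x(1) prime_subset_mm[OF Q(1)] by blast
  then have xc: "x \<in> carrier R" by (rule mm_carrier)
  have nzx: "nzd_mod {\<zero>} x" using nzd_mod_iff_notin_ass[OF zeroideal xc] x(2) by blast
  have Qi: "ideal Q R" using primeideal.axioms(1)[OF Q(1)] .
  have "Q \<in> ass (adjoin {\<zero>} x)"
  proof (rule minimal_over_imp_ass[OF adjoin_ideal[OF zeroideal xc] Q(1)])
    show "adjoin {\<zero>} x \<subseteq> Q" using adjoin_least[OF Qi _ x(1)] ideal_zero[OF Qi] by simp
    fix P assume P: "primeideal P R" "adjoin {\<zero>} x \<subseteq> P" "P \<subseteq> Q"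
    show "P = Q"
    proof (rule ccontr)
      assume "P \<noteq> Q"
      obtain P0 where P0: "P0 \<in> minimal_primes R" "P0 \<subseteq> P"
        using exists_minimal_prime_below[OF P(1)] by blast
      have "x \<in> P" using P(2) adjoin_superset(2)[OF zeroideal xc] by blast
      moreover have "x \<notin> P0" using x(2) P0(1) by (simp add: minimal_primes_eq_ass)
      ultimately have chain: "set [P0, P, Q] \<subseteq> Spec R" "sorted_wrt (\<subset>) [P0, P, Q]"
        using P P0 Q(1) \<open>P \<noteq> Q\<close> minimal_primesD(1)[OF P0(1)] by (auto simp: Spec_def)
      then have "prime_chain [P0, P, Q]" by (simp add: prime_chain_def)
      then have "ereal (real (length [P0, P, Q]) - 1) \<le> height_prime R Q"
        by (rule prime_chain_length_le_height) simp
      then have "ereal (real (length [P0, P, Q]) - 1) \<le> 1" using Q(2) by (rule order_trans)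
      then show False by (simp add: one_ereal_def)
    qed
  qed
  then have "Q \<in> ass (adjoin_list {\<zero>} [x])" "regseq {\<zero>} [x]" using xm nzx by auto
  then obtain d c where "krull_dim R = ereal (real d)" "length [x] \<le> d" "prime_chain c" "hd c = Q"
    "length c = Suc (d - length [x])"
    using exists_dim_chains by blast
  then show ?thesis by (intro exI[of _ c]) (simp add: one_ereal_def)
qed

text \<open>Suppose that all minimal primes lie outside \<open>Z\<close>, and follow a path of minimal primes from one part
  of the complement to the other. Where the path changes parts, a prime above both neighbours can
  belong to neither part, because the parts contain every prime below one of their members.\<close>
lemma exists_codim_1_prime_in_separator:
  assumes Z: "closedin (zariski_topology R) Z"
    and disc: "disconnected_space (subtopology (zariski_topology R) (topspace (zariski_topology R) - Z))"
  shows "\<exists>Q \<in> Z. primeideal Q R \<and> height_prime R Q \<le> 1"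
proof (cases "minimal_primes R \<inter> Z = {}")
  case False
  then obtain Q where Q: "Q \<in> minimal_primes R" "Q \<in> Z" by blast
  then have "height_prime R Q \<le> 0"
    using height_prime_ass_le[of "[]" Q] by (simp add: minimal_primes_eq_ass zero_ereal_def)
  then have "height_prime R Q \<le> 1" by (rule order_trans) simp
  then show ?thesis using Q minimal_primesD(1) by blast
next
  case noZ: True
  let ?X = "zariski_topology R"
  let ?C = "topspace ?X - Z"
  have C: "openin ?X ?C" using Z by (rule openin_diff[OF openin_topspace])
  obtain p0 where p0: "p0 \<in> minimal_primes R"
    using exists_minimal_prime_below[OF mm_prime] by blast
  have minC: "m \<in> ?C" if "m \<in> minimal_primes R" for m
    using that noZ by (auto simp: topspace_zariski minimal_primes_def)
  then have "topspace (subtopology ?X ?C) \<noteq> {}" using p0 by auto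
  then have "\<not> connected_space (subtopology ?X ?C)" using disc by (simp add: disconnected_space_def)
  then obtain U V where UV: "openin (subtopology ?X ?C) U" "openin (subtopology ?X ?C) V"
    "topspace (subtopology ?X ?C) \<subseteq> U \<union> V" "U \<inter> V = {}" "U \<noteq> {}" "V \<noteq> {}"
    unfolding connected_space_def by blast
  then have UV': "openin ?X U" "openin ?X V" "?C = U \<union> V"
    using openin_open_subtopology[OF C] by auto
  have down: "P \<in> W" if "openin ?X W" "Q \<in> W" "P \<subseteq> Q" "P \<in> Spec R" for P Q W
    using that unfolding openin_zariski by blast
  have meets: "\<exists>m \<in> minimal_primes R. m \<in> W" if W: "openin ?X W" "W \<noteq> {}" for W
  proof -
    obtain Q where Q: "Q \<in> W" using W(2) by blast
    then have "primeideal Q R"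
      using openin_subset[OF W(1)] by (auto simp: topspace_zariski Spec_def)
    then obtain m where "m \<in> minimal_primes R" "m \<subseteq> Q" using exists_minimal_prime_below by blast
    then show ?thesis using down[OF W(1) Q] by (auto simp: minimal_primes_def)
  qed
  obtain p p' where p: "p \<in> minimal_primes R" "p \<in> U" and p': "p' \<in> minimal_primes R" "p' \<in> V"
    using meets UV' UV(5,6) by metis
  have "p <+>\<^bsub>R\<^esub> p' \<subseteq> \<mm>"
    using prime_subset_mm[OF minimal_primesD(1)[OF p(1)]] prime_subset_mm[OF minimal_primesD(1)[OF p'(1)]]
      ideal_add[OF mm_ideal] unfolding set_add_def' by blast
  then obtain ps where ps: "ps \<noteq> []" "hd ps = p" "last ps = p'"
    "\<forall>j < length ps. ps ! j \<in> minimal_primes R \<and> ps ! j \<subseteq> \<mm>"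
    "\<forall>i. i + 1 < length ps \<longrightarrow> height R (ps ! i <+>\<^bsub>R\<^esub> ps ! (i + 1)) \<le> 1"
    using exists_codim_1_path[OF p(1) p'(1) mm_prime] by blast
  have "\<exists>i. i + 1 < length ps \<and> ps ! i \<in> U \<and> ps ! (i + 1) \<in> V"
  proof (rule ccontr)
    assume no_step: "\<not> ?thesis"
    have "j < length ps \<Longrightarrow> ps ! j \<in> U" for j
    proof (induction j)
      case 0
      then show ?case using ps(1,2) p(2) by (simp add: hd_conv_nth)
    next
      case (Suc j)
      then have "ps ! j \<in> U" "ps ! Suc j \<in> U \<union> V" using minC ps(4) UV'(3) by auto
      then show ?case using no_step Suc.prems by auto
    qed
    then have "p' \<in> U" using ps(1,3) by (metis diff_less last_conv_nth length_greater_0_conv zero_less_one)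
    then show False using p'(2) UV(4) by blast
  qed
  then obtain i where i: "i + 1 < length ps" "ps ! i \<in> U" "ps ! (i + 1) \<in> V" by blast
  define u where "u = ps ! i"
  define v where "v = ps ! (i + 1)"
  have uv: "u \<in> minimal_primes R" "v \<in> minimal_primes R" "u \<in> U" "v \<in> V" "height R (u <+>\<^bsub>R\<^esub> v) \<le> 1"
    using ps i by (auto simp: u_def v_def)
  have "height R (u <+>\<^bsub>R\<^esub> v) < 2" using uv(5) by (rule order_le_less_trans) simp
  then obtain Q where Q: "primeideal Q R" "u <+>\<^bsub>R\<^esub> v \<subseteq> Q" "height_prime R Q < 2"
    unfolding height_def INF_less_iff by (auto simp: Spec_def)
  have uvQ: "u \<subseteq> Q" "v \<subseteq> Q"
    using summands_subset_sum[OF minimal_primesD(2)[OF uv(1)] minimal_primesD(2)[OF uv(2)]] Q(2) by auto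
  have spec: "u \<in> Spec R" "v \<in> Spec R" "Q \<in> Spec R"
    using uv Q(1) by (auto simp: minimal_primes_def Spec_def)
  have "Q \<notin> U" using down[OF UV'(2) uv(4)] down[OF UV'(1) _ uvQ(2) spec(2)] uv(4) UV(4) by blast
  moreover have "Q \<notin> V" using down[OF UV'(2) _ uvQ(1) spec(1)] uv(3) UV(4) by blast
  ultimately have "Q \<in> Z" using UV'(3) spec(3) by (auto simp: topspace_zariski)
  moreover have "height_prime R Q \<le> 1"
    unfolding one_ereal_def
  proof (rule height_prime_le[where n = 1, simplified])
    fix c assume "prime_chain c" "last c = Q"
    then have "ereal (real (length c) - 1) \<le> height_prime R Q" by (rule prime_chain_length_le_height)
    then have "ereal (real (length c) - 1) < 2" using Q(3) by (rule order_le_less_trans)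
    then show "length c \<le> Suc (Suc 0)" by (simp add: numeral_eq_ereal)
  qed
  ultimately show ?thesis using Q(1) by blast
qed

lemma connected_in_codim_1: "connected_in_codim_1 R"
  unfolding connected_in_codim_1_def connectivity_dim_def
proof (rule Inf_greatest)
  fix e
  assume "e \<in> {top_dim (subtopology (zariski_topology R) Z) | Z. closedin (zariski_topology R) Z \<and>
    disconnected_space (subtopology (zariski_topology R) (topspace (zariski_topology R) - Z))}"
  then obtain Z where Z: "e = top_dim (subtopology (zariski_topology R) Z)"
    "closedin (zariski_topology R) Z"
    "disconnected_space (subtopology (zariski_topology R) (topspace (zariski_topology R) - Z))" by blast
  obtain Q where Q: "Q \<in> Z" "primeideal Q R" "height_prime R Q \<le> 1"
    using exists_codim_1_prime_in_separator[OF Z(2,3)] by blast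
  obtain c where c: "prime_chain c" "hd c = Q" "krull_dim R - 1 \<le> ereal (real (length c) - 1)"
    using exists_codim_1_chain[OF Q(2,3)] by blast
  have "ereal (real (length c) - 1) \<le> e"
    unfolding Z(1) by (rule top_dim_closed_ge[OF Z(2) c(1)]) (use c(2) Q(1) in simp)
  with c(3) show "krull_dim R - 1 \<le> e" by (rule order_trans)
qed

end

theorem corollary2p12:
  fixes R :: "('a, 'm) ring_scheme" and \<mm> :: "'a set"
  assumes "cohen_macaulay_local_ring R \<mm>"
  shows "(\<forall>\<pp> \<in> minimal_primes R. \<forall>\<pp>' \<in> minimal_primes R.
            \<forall>P. primeideal P R \<and> \<pp> <+>\<^bsub>R\<^esub> \<pp>' \<subseteq> P \<longrightarrow>
              (\<exists>ps. ps \<noteq> [] \<and> hd ps = \<pp> \<and> last ps = \<pp>' \<and>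
                 (\<forall>j < length ps. ps ! j \<in> minimal_primes R \<and> ps ! j \<subseteq> P) \<and>
                 (\<forall>i. i + 1 < length ps \<longrightarrow>
                    height R (ps ! i <+>\<^bsub>R\<^esub> ps ! (i + 1)) \<le> 1)))
         \<and> connected_in_codim_1 R"
proof -
  interpret cohen_macaulay_local_ring R \<mm> by (rule assms)
  show ?thesis using exists_codim_1_path connected_in_codim_1 by blast
qed

end
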